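(* Let $K \geq 2$ be an integer and let $\epsilon > 0$ be sufficiently small. Then there exists $x_0 = x_0(K,\epsilon)$ such that for every $x \geq x_0$ there exist at least $x^{1-\epsilon}$ integers $n \in [x, (1+K^{-1})x]$ such that $$\omega(nj + a^h k) \geq (\log\log\log x)^{\frac{1}{3}-\epsilon} \quad\text{and}\quad \omega(nj - a^h k) \geq (\log\log\log x)^{\frac{1}{3}-\epsilon}$$ for all integers $2 \leq a \leq K$, $1 \leq j, k \leq K$ and $0 \leq h \leq K\log x$.
   Context: $\omega(m)$ denotes the number of distinct prime factors of the integer $m$ (applied to $|m|$ if $m<0$). *)

theory Defs
  imports "HOL-Computational_Algebra.Primes" Complex_Main
begin

text \<open>omega m = number of distinct prime factors of |m| (omega 0 = 0).\<close>
definition omega :: "int \<Rightarrow> nat" where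
  "omega m = card (prime_factors \<bar>m\<bar>)"

end

theory Submission
  imports Defs "HOL-Number_Theory.Number_Theory" "HOL-Analysis.Harmonic_Numbers"
    "HOL-Real_Asymp.Real_Asymp"
begin

text \<open>
  We force the prime divisors by prescribing \<open>n\<close> modulo a product \<open>W \<le> x\<^bsup>\<epsilon>/2+o(1)\<^esup>\<close> of primes; the
  members of a residue class modulo \<open>W\<close> are then numerous enough. Fix \<open>a\<close>, \<open>j\<close>, \<open>k\<close> and a sign.
  If \<open>a\<close> has order \<open>m\<close> modulo \<open>p\<close>, one residue of \<open>n\<close> modulo \<open>p\<close> makes \<open>p\<close> divide
  \<open>n j \<plusminus> a\<^sup>h k\<close> for all \<open>h\<close> in a residue class modulo \<open>m\<close>. Choosing the classes greedily, primes with
  orders \<open>m \<in> D\<close> leave at most a proportion \<open>exp (- \<Sum>m\<in>D. 1/m)\<close> of the exponents \<open>h\<close> uncovered,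
  and each uncovered \<open>h\<close> gets a small prime of its own. Independent copies of this covering, one for
  each prime divisor wanted, use disjoint sets of primes.

  The orders come from a weak form of Zsigmondy's theorem: if \<open>m\<close> is odd and
  \<open>\<Sum>q. 1/q \<le> 1/2\<close> over the primes \<open>q\<close> dividing \<open>m\<close>, then \<open>a\<^sup>m - 1\<close> has a primitive prime divisor,
  as otherwise \<open>a\<^sup>m - 1\<close> would divide \<open>m \<cdot> \<Prod>q. (a\<^bsup>m/q\<^esup> - 1)\<close>, which is too small. On average
  \<open>\<Sum>q. 1/q\<close> is at most \<open>1/4\<close> for odd \<open>m\<close>, so these \<open>m\<close> have harmonic sum of order \<open>ln N\<close> up to \<open>N\<close>.
\<close>

section \<open>Primitive prime divisors\<close>

text \<open>Modulo \<open>p^2\<close> the powers of \<open>1 + p * t\<close> are linear in the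
  exponent, so the sum is \<open>p\<close> plus \<open>p * t\<close> times
  \<open>0 + ... + (p - 1)\<close>. For odd \<open>p\<close> the latter sum is a multiple of
  \<open>p\<close>, and only \<open>p\<close> survives.\<close>

lemma not_square_dvd_geometric_sum:
  fixes p t :: nat
  assumes "prime p" "odd p"
  shows "\<not> p\<^sup>2 dvd (\<Sum>i<p. (1 + p * t) ^ i)"
proof
  have pow: "[(1 + p * t) ^ i = 1 + i * p * t] (mod p\<^sup>2)" for i
  proof (induction i)
    case (Suc i)
    have "[(1 + p * t) ^ Suc i = (1 + p * t) * (1 + i * p * t)] (mod p\<^sup>2)"
      unfolding power_Suc using Suc by (intro cong_mult cong_refl)
    also have "(1 + p * t) * (1 + i * p * t) = 1 + Suc i * p * t + p\<^sup>2 * (i * t * t)"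
      by (simp add: algebra_simps power2_eq_square)
    also have "[\<dots> = 1 + Suc i * p * t] (mod p\<^sup>2)"
      unfolding unique_euclidean_semiring_class.cong_def by (rule mod_mult_self2)
    finally show ?case .
  qed simp
  obtain r where r: "p = 2 * r + 1"
    using assms(2) by (elim oddE)
  have "(\<Sum>i<p. i) = p * r"
    using Sum_Ico_nat[of 0 p] r by (simp add: atLeast0LessThan)
  then have "(\<Sum>i<p. 1 + i * p * t) = p + p\<^sup>2 * (r * t)"
    by (simp only: sum.distrib sum_distrib_right[symmetric])
       (simp add: power2_eq_square algebra_simps)
  then have "[(\<Sum>i<p. (1 + p * t) ^ i) = p + p\<^sup>2 * (r * t)] (mod p\<^sup>2)"
    using cong_sum[of "{..<p}" "\<lambda>i. (1 + p * t) ^ i", OF pow] by simp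
  also have "[p + p\<^sup>2 * (r * t) = p] (mod p\<^sup>2)"
    by (simp add: unique_euclidean_semiring_class.cong_def)
  finally have c: "[(\<Sum>i<p. (1 + p * t) ^ i) = p] (mod p\<^sup>2)" .
  assume "p\<^sup>2 dvd (\<Sum>i<p. (1 + p * t) ^ i)"
  with c have "p\<^sup>2 dvd p"
    using cong_dvd_iff by blast
  then have "p\<^sup>2 \<le> p"
    using assms(1) prime_gt_0_nat by (intro dvd_imp_le) auto
  then show False
    using prime_gt_1_nat[OF assms(1)] by (simp add: power2_eq_square)
qed

text \<open>Half of lifting the exponent: the quotient of \<open>a ^ (m * q) - 1\<close> by
  \<open>a ^ m - 1\<close> is a geometric sum in \<open>b = a ^ m\<close>, congruent to
  \<open>q\<close> modulo \<open>p\<close>. It is thus prime to \<open>p\<close> unless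
  \<open>p = q\<close>, and then the previous lemma allows only one factor \<open>p\<close>.\<close>

lemma multiplicity_power_minus_one_le:
  fixes a m p q :: nat
  assumes p: "prime p" "odd p" and q: "prime q" and a: "a \<ge> 2" and m: "m > 0"
    and dvd: "p dvd a ^ m - 1"
  shows "multiplicity p (a ^ (m * q) - 1) \<le> multiplicity p (q * (a ^ m - 1))"
proof -
  define b where "b = a ^ m"
  have b: "b > 1"
    using a m one_less_power[of a m] by (simp add: b_def)
  obtain t where "b - 1 = p * t"
    using dvd by (auto simp: b_def)
  then have t: "b = 1 + p * t"
    using b by simp
  define S where "S = (\<Sum>i<q. b ^ i)"
  have "int (b ^ q - 1) = int ((b - 1) * S)"
    using b power_diff_1_eq[of "int b" q] by (simp add: S_def of_nat_diff)
  then have fact: "a ^ (m * q) - 1 = (b - 1) * S"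
    by (simp only: of_nat_eq_iff b_def power_mult)
  have S0: "S > 0"
    using q prime_gt_0_nat[of q] b by (auto simp: S_def sum_pos2[of _ 0])
  have "multiplicity p S \<le> multiplicity p q"
  proof (cases "p = q")
    case True
    have "\<not> p\<^sup>2 dvd S"
      using not_square_dvd_geometric_sum[OF p] True t by (simp add: S_def)
    then have "multiplicity p S < 2"
      using multiplicity_dvd' by (metis not_less)
    then show ?thesis
      using True p by simp
  next
    case False
    have "[b = 1] (mod p)"
      unfolding unique_euclidean_semiring_class.cong_def t by (rule mod_mult_self2)
    then have "[b ^ i = 1] (mod p)" for i
      using cong_pow by fastforce
    then have "[S = (\<Sum>i<q. 1)] (mod p)"
      unfolding S_def by (intro cong_sum)
    then have "[S = q] (mod p)"
      by simp
    moreover have "\<not> p dvd q"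
      using False p q primes_dvd_imp_eq by blast
    ultimately have "\<not> p dvd S"
      using cong_dvd_iff by blast
    then show ?thesis
      by (simp add: not_dvd_imp_multiplicity_0)
  qed
  then show ?thesis
    using S0 b p(1) q unfolding fact b_def[symmetric]
    by (subst (1 2) prime_elem_multiplicity_mult_distrib) (auto simp: prime_gt_0_nat)
qed

text \<open>Compare multiplicities prime by prime. Without primitivity the order of \<open>a\<close>
  modulo \<open>p\<close> is a proper divisor of \<open>n\<close>, hence divides
  \<open>n div q\<close> for some prime \<open>q\<close> dividing \<open>n\<close>. Lifting from
  \<open>n div q\<close> to \<open>n\<close> costs at most the factor \<open>q\<close>, which
  \<open>n\<close> supplies.\<close>

lemma power_minus_one_dvd_if_no_primitive_prime:
  fixes a n :: nat
  assumes a: "a \<ge> 2" and n: "odd n"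
    and no: "\<And>p. prime p \<Longrightarrow> p dvd a ^ n - 1 \<Longrightarrow> \<exists>m. 0 < m \<and> m < n \<and> p dvd a ^ m - 1"
  shows "a ^ n - 1 dvd n * (\<Prod>q\<in>prime_factors n. a ^ (n div q) - 1)"
    (is "_ dvd ?R")
proof (rule multiplicity_le_imp_dvd)
  have n0: "n > 0"
    using n by (cases n) auto
  have gt1: "a ^ k > 1" if "k > 0" for k
    using a that one_less_power[of a k] by simp
  have div0: "n div q > 0" if "q \<in> prime_factors n" for q
    using that n0 by (auto simp: in_prime_factors_iff div_greater_zero_iff dvd_imp_le prime_gt_0_nat)
  have R0: "?R \<noteq> 0"
    using n0 gt1[OF div0] by fastforce
  show "a ^ n - 1 \<noteq> 0"
    using gt1[OF n0] by simp
  fix p :: nat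
  assume p: "prime p"
  show "multiplicity p (a ^ n - 1) \<le> multiplicity p ?R"
  proof (cases "p dvd a ^ n - 1")
    case False
    then show ?thesis
      by (simp add: not_dvd_imp_multiplicity_0)
  next
    case True
    have ordd: "p dvd a ^ k - 1 \<longleftrightarrow> ord p a dvd k" for k
    proof -
      have "p dvd a ^ k - 1 \<longleftrightarrow> [a ^ k = 1] (mod p)"
        using a by (simp add: cong_altdef_nat)
      then show ?thesis
        using ord_divides[of a k p] by simp
    qed
    obtain m where m: "0 < m" "m < n" "p dvd a ^ m - 1"
      using no[OF p True] by blast
    define g where "g = ord p a"
    have "g dvd n" "g dvd m"
      using m True ordd g_def by auto
    then obtain r where r: "n = g * r"
      by (auto elim: dvdE)
    have "g \<le> m"
      using \<open>g dvd m\<close> m by (simp add: dvd_imp_le)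
    then have "r \<noteq> 1"
      using r m by auto
    then obtain q where q: "prime q" "q dvd r"
      using prime_factor_nat by blast
    have qn: "q dvd n"
      using q r by simp
    have qf: "q \<in> prime_factors n"
      using q qn n0 by (simp add: in_prime_factors_iff)
    have "g dvd n div q"
      using q r by (metis div_mult_swap dvd_triv_left)
    then have dq: "p dvd a ^ (n div q) - 1"
      using ordd g_def by simp
    have decomp: "(n div q) * q = n"
      using qn by simp
    have bound: "multiplicity p (a ^ n - 1) \<le> multiplicity p (q * (a ^ (n div q) - 1))"
    proof (cases "p = 2")
      case False
      then have "odd p"
        using p primes_dvd_imp_eq two_is_prime_nat by blast
      then show ?thesis
        using multiplicity_power_minus_one_le[OF p _ q(1) a div0[OF qf] dq] decomp by simp
    next
      \<comment> \<open>Lifting fails for \<open>p = 2\<close> in general, but here the geometric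
        sum has an odd number \<open>q\<close> of odd terms and contributes no factor 2.\<close>
      case True
      define b where "b = a ^ (n div q)"
      have b: "b > 1"
        using gt1[OF div0[OF qf]] by (simp add: b_def)
      define S where "S = (\<Sum>i<q. b ^ i)"
      have "int (b ^ q - 1) = int ((b - 1) * S)"
        using b power_diff_1_eq[of "int b" q] by (simp add: S_def of_nat_diff)
      then have fact: "a ^ n - 1 = (b - 1) * S"
        by (simp only: of_nat_eq_iff b_def power_mult[symmetric] decomp)
      have "odd b"
        using dq b True by (simp add: b_def[symmetric])
      moreover have "odd q"
        using qn n by (metis dvd_trans)
      ultimately have "odd S"
        by (simp add: S_def even_sum_iff)
      then have "multiplicity p S = 0"
        using True by (simp add: not_dvd_imp_multiplicity_0)
      moreover have "S > 0"
        using \<open>odd S\<close> by (cases S) auto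
      ultimately show ?thesis
        using b p q(1) unfolding fact b_def[symmetric]
        by (subst (1 2) prime_elem_multiplicity_mult_distrib) (auto simp: prime_gt_0_nat)
    qed
    have "q * (a ^ (n div q) - 1) dvd ?R"
      using qf qn by (intro mult_dvd_mono dvd_prodI) auto
    then have "multiplicity p (q * (a ^ (n div q) - 1)) \<le> multiplicity p ?R"
      using R0 by (intro dvd_imp_multiplicity_le)
    with bound show ?thesis
      by linarith
  qed
qed

text \<open>Otherwise \<open>a ^ n - 1\<close> would be at most \<open>n * a ^ E\<close>, where
  \<open>E\<close> sums the exponents \<open>n div q\<close>. The hypothesis on the reciprocals says
  exactly that \<open>E \<le> n / 2\<close>, so \<open>a ^ n\<close> is far larger.\<close>

lemma exists_primitive_prime:
  fixes a n :: nat
  assumes a: "a \<ge> 2" and n: "odd n" "n \<ge> 9"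
    and half: "(\<Sum>q\<in>prime_factors n. 1 / real q) \<le> 1 / 2"
  shows "\<exists>p. prime p \<and> p dvd a ^ n - 1 \<and> (\<forall>m. 0 < m \<and> m < n \<longrightarrow> \<not> p dvd a ^ m - 1)"
proof (rule ccontr)
  assume "\<not> ?thesis"
  then have dvd: "a ^ n - 1 dvd n * (\<Prod>q\<in>prime_factors n. a ^ (n div q) - 1)"
    by (intro power_minus_one_dvd_if_no_primitive_prime[OF a n(1)]) blast
  define E where "E = (\<Sum>q\<in>prime_factors n. n div q)"
  have "real E = real n * (\<Sum>q\<in>prime_factors n. 1 / real q)"
    unfolding E_def of_nat_sum sum_distrib_left
    by (intro sum.cong) (auto simp: in_prime_factors_iff real_of_nat_div)
  also have "\<dots> \<le> real n * (1 / 2)"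
    using half by (intro mult_left_mono) auto
  finally have "2 * E \<le> n"
    by linarith
  define m where "m = n - E"
  have m: "n = m + E" "n \<le> 2 * m" "m \<ge> 5"
    using \<open>2 * E \<le> n\<close> n by (auto simp: m_def)
  \<comment> \<open>Applied to \<open>m = n - E\<close>: since \<open>n \<le> 2 * m\<close>, it
    gives \<open>2 ^ m \<ge> n + 2\<close>. The bound \<open>n \<ge> 9\<close> ensures that
    \<open>m\<close> is large enough.\<close>
  have two: "2 ^ m \<ge> 2 * m + 2" if "m \<ge> 3" for m :: nat
    using that by (induction m rule: dec_induct) auto
  have "a ^ n = a ^ m * a ^ E"
    using m by (simp add: power_add)
  moreover have "a ^ m \<ge> 2 ^ m"
    using a by (simp add: power_mono)
  ultimately have big: "a ^ n \<ge> (n + 2) * a ^ E"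
    using two[of m] m by (simp only:) (intro mult_right_mono, linarith+)
  have "(\<Prod>q\<in>prime_factors n. a ^ (n div q) - 1) \<le> (\<Prod>q\<in>prime_factors n. a ^ (n div q))"
    by (intro prod_mono) auto
  also have "\<dots> = a ^ E"
    by (simp add: E_def power_sum)
  finally have le: "n * (\<Prod>q\<in>prime_factors n. a ^ (n div q) - 1) \<le> n * a ^ E"
    by simp
  have "n * (\<Prod>q\<in>prime_factors n. a ^ (n div q) - 1) > 0"
  proof -
    have "a ^ (n div q) > 1" if "q \<in> prime_factors n" for q
      using that a n by (intro one_less_power) (auto simp: in_prime_factors_iff div_greater_zero_iff dvd_imp_le prime_gt_0_nat)
    then show ?thesis
      using n by (fastforce intro!: prod_pos)
  qed
  with dvd have "a ^ n - 1 \<le> n * (\<Prod>q\<in>prime_factors n. a ^ (n div q) - 1)"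
    by (rule dvd_imp_le)
  with le big have "(n + 2) * a ^ E - 1 \<le> n * a ^ E"
    by linarith
  moreover have "a ^ E \<ge> 1"
    using a by simp
  ultimately show False
    by (simp add: algebra_simps)
qed

section \<open>Harmonic sums and greedy coverings\<close>

text \<open>The orders at which every base \<open>a \<ge> 2\<close> has a primitive prime divisor by
  \<open>exists_primitive_prime\<close>; the set is the same for all bases.\<close>

definition light :: "nat set" where
  "light = {n. odd n \<and> 9 \<le> n \<and> (\<Sum>q\<in>prime_factors n. 1 / real q) \<le> 1 / 2}"

text \<open>Each even number is paired with its odd predecessor, so the odd numbers carry at least
  half of \<open>harm N\<close>.\<close>

lemma sum_odd_reciprocals_ge:
  assumes "N \<ge> 1"
  shows "ln (real N) / 2 \<le> (\<Sum>n | odd n \<and> n \<le> N. 1 / real n)"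
proof -
  define O' where "O' = {n. odd n \<and> n \<le> N}"
  define E where "E = {n. even n \<and> 1 \<le> n \<and> n \<le> N}"
  have fin: "finite O'" "finite E"
    by (auto simp: O'_def E_def)
  have "(\<Sum>n\<in>E. 1 / real n) \<le> (\<Sum>n\<in>O'. 1 / real n)"
    using fin(2,1)
  proof (rule sum_le_included[where i = Suc])
    show "\<forall>x\<in>E. \<exists>y\<in>O'. Suc y = x \<and> 1 / real x \<le> 1 / real y"
    proof
      fix n assume n: "n \<in> E"
      then obtain m where "n = Suc m"
        by (cases n) (auto simp: E_def)
      with n show "\<exists>y\<in>O'. Suc y = n \<and> 1 / real n \<le> 1 / real y"
        by (intro bexI[of _ m]) (auto simp: E_def O'_def frac_le odd_pos)
    qed
  qed auto
  moreover have "harm N = (\<Sum>n\<in>E. 1 / real n) + (\<Sum>n\<in>O'. 1 / real n)"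
  proof -
    have "{1..N} = E \<union> O'" "E \<inter> O' = {}"
      by (auto simp: E_def O'_def Suc_le_eq odd_pos)
    then show ?thesis
      using fin by (simp add: harm_def sum.union_disjoint inverse_eq_divide)
  qed
  moreover have "ln (real N) \<le> harm N"
    using ln_le_harm[of N] assms by (intro order.trans[OF _ ln_le_harm]) auto
  ultimately show ?thesis
    unfolding O'_def by linarith
qed

lemma sum_Un_le:
  fixes f :: "'a \<Rightarrow> real"
  assumes "finite A" "finite B" "\<And>x. f x \<ge> 0"
  shows "sum f (A \<union> B) \<le> sum f A + sum f B"
  using assms by (simp add: sum_Un sum_nonneg)

text \<open>A first moment argument: weighted by \<open>1 / n\<close>, the odd numbers have mean
  \<open>\<sigma>\<close> at most \<open>1/4\<close>, so those with \<open>\<sigma> n > 1/2\<close>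
  carry at most half of the harmonic sum \<open>h\<close>.\<close>

lemma sum_light_reciprocals_ge:
  assumes "N \<ge> 1"
  shows "ln (real N) / 4 - 2 \<le> (\<Sum>n\<in>light \<inter> {..N}. 1 / real n)"
proof -
  define O' where "O' = {n. odd n \<and> n \<le> N}"
  define \<sigma> where "\<sigma> n = (\<Sum>q\<in>prime_factors n. 1 / real q)" for n
  define h where "h = (\<Sum>n\<in>O'. 1 / real n)"
  have fin: "finite O'"
    by (auto simp: O'_def)
  have \<sigma>0: "\<sigma> n \<ge> 0" for n
    by (simp add: \<sigma>_def sum_nonneg)
  \<comment> \<open>The constant \<open>1/4\<close> comes from comparing
    \<open>1 / (2 * i + 1)^2\<close> with \<open>1 / (4 * i * (i + 1))\<close>, which
    telescopes.\<close>
  have tele: "(\<Sum>i=1..m. 1 / real i - 1 / real (Suc i)) = 1 - 1 / real (Suc m)" for m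
    by (induction m) auto
  have "(\<Sum>i=1..N. 1 / (real (2 * i + 1))\<^sup>2) \<le> (\<Sum>i=1..N. (1 / real i - 1 / real (Suc i)) / 4)"
  proof (rule sum_mono)
    fix i assume "i \<in> {1..N}"
    then have i: "real i > 0"
      by auto
    have "(1 / real i - 1 / real (Suc i)) / 4 = 1 / (4 * real i * (real i + 1))"
      using i by (simp add: field_simps)
    moreover have "4 * real i * (real i + 1) \<le> (real (2 * i + 1))\<^sup>2"
      by (simp add: power2_eq_square algebra_simps)
    ultimately show "1 / (real (2 * i + 1))\<^sup>2 \<le> (1 / real i - 1 / real (Suc i)) / 4"
      using i by (simp only:) (intro frac_le, auto)
  qed
  also have "\<dots> \<le> 1 / 4"
    by (simp only: tele sum_divide_distrib[symmetric]) simp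
  finally have quarter: "(\<Sum>i=1..N. 1 / (real (2 * i + 1))\<^sup>2) \<le> 1 / 4" .
  have "(\<Sum>n\<in>O'. \<sigma> n / real n) = (\<Sum>(n, q)\<in>Sigma O' prime_factors. 1 / (real q * real n))"
    using fin by (simp add: \<sigma>_def sum.Sigma[symmetric] sum_divide_distrib)
  \<comment> \<open>Writing \<open>n = q * m\<close> with \<open>q = 2 * i + 1\<close> turns the
    term into \<open>1 / q^2\<close> times \<open>1 / m\<close>. Letting \<open>q\<close> run over
    all odd numbers from 3 on, not only primes, makes the sum a product.\<close>
  also have "\<dots> \<le> (\<Sum>(i, m)\<in>{1..N} \<times> O'. 1 / (real (2 * i + 1))\<^sup>2 * (1 / real m))"
  proof (rule sum_le_included[where i = "\<lambda>(i, m). ((2 * i + 1) * m, 2 * i + 1)"])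
    show "\<forall>x\<in>Sigma O' prime_factors. \<exists>y\<in>{1..N} \<times> O'.
        (case y of (i, m) \<Rightarrow> ((2 * i + 1) * m, 2 * i + 1)) = x \<and>
        (case x of (n, q) \<Rightarrow> 1 / (real q * real n))
          \<le> (case y of (i, m) \<Rightarrow> 1 / (real (2 * i + 1))\<^sup>2 * (1 / real m))"
    proof (clarify)
      fix n q assume n: "n \<in> O'" and q: "q \<in> prime_factors n"
      then obtain m where m: "n = q * m"
        by (auto simp: in_prime_factors_iff)
      have "odd q" "odd m" "m \<le> n" "q \<le> n"
        using n m by (auto simp: O'_def Suc_le_eq odd_pos)
      then obtain i where i: "q = 2 * i + 1"
        by (elim oddE)
      have "q > 1"
        using q prime_gt_1_nat by (auto simp: in_prime_factors_iff)
      then have "(i, m) \<in> {1..N} \<times> O'"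
        using i n \<open>odd m\<close> \<open>m \<le> n\<close> \<open>q \<le> n\<close> by (auto simp: O'_def)
      then show "\<exists>y\<in>{1..N} \<times> O'. (case y of (i, m) \<Rightarrow> ((2 * i + 1) * m, 2 * i + 1)) = (n, q) \<and>
          1 / (real q * real n)
            \<le> (case y of (i, m) \<Rightarrow> 1 / (real (2 * i + 1))\<^sup>2 * (1 / real m))"
        by (intro bexI[of _ "(i, m)"]) (simp_all add: i m power2_eq_square algebra_simps)
    qed
  qed (use fin in auto)
  also have "\<dots> = (\<Sum>i=1..N. 1 / (real (2 * i + 1))\<^sup>2) * h"
    by (simp add: h_def sum_product sum.cartesian_product)
  also have "\<dots> \<le> 1 / 4 * h"
    using quarter by (intro mult_right_mono) (auto simp: h_def sum_nonneg)
  finally have avg: "(\<Sum>n\<in>O'. \<sigma> n / real n) \<le> h / 4"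
    by simp
  \<comment> \<open>Markov's inequality with threshold \<open>1/2\<close>.\<close>
  define Bad where "Bad = {n \<in> O'. \<sigma> n > 1 / 2}"
  have "(\<Sum>n\<in>Bad. 1 / real n) \<le> (\<Sum>n\<in>Bad. 2 * (\<sigma> n / real n))"
  proof (rule sum_mono)
    fix n assume "n \<in> Bad"
    then have "1 / real n \<le> (2 * \<sigma> n) / real n"
      by (intro divide_right_mono) (auto simp: Bad_def)
    then show "1 / real n \<le> 2 * (\<sigma> n / real n)"
      by simp
  qed
  also have "\<dots> \<le> (\<Sum>n\<in>O'. 2 * (\<sigma> n / real n))"
    using fin \<sigma>0 by (intro sum_mono2) (auto simp: Bad_def)
  also have "\<dots> \<le> h / 2"
    using avg by (simp only: sum_distrib_left[symmetric])
  finally have bad: "(\<Sum>n\<in>Bad. 1 / real n) \<le> h / 2" .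
  \<comment> \<open>The odd numbers below 9 are not in \<open>light\<close>; their reciprocals add
    up to less than 2, which is the loss in the statement.\<close>
  have "h \<le> (\<Sum>n\<in>(light \<inter> {..N}) \<union> Bad \<union> {1,3,5,7}. 1 / real n)"
    unfolding h_def
  proof (rule sum_mono2)
    show "O' \<subseteq> light \<inter> {..N} \<union> Bad \<union> {1, 3, 5, 7}"
    proof
      fix n assume n: "n \<in> O'"
      have "n \<in> {1, 3, 5, 7} \<or> 9 \<le> n"
      proof (rule ccontr)
        assume "\<not> ?thesis"
        then have "n \<in> {0, 2, 4, 6, 8}"
          by (simp, linarith)
        then show False
          using n by (auto simp: O'_def)
      qed
      then show "n \<in> light \<inter> {..N} \<union> Bad \<union> {1, 3, 5, 7}"
        using n by (auto simp: light_def Bad_def \<sigma>_def O'_def)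
    qed
  qed (use fin in \<open>auto simp: Bad_def\<close>)
  also have "\<dots> \<le> (\<Sum>n\<in>(light \<inter> {..N}) \<union> Bad. 1 / real n) + (\<Sum>n\<in>{1,3,5,7::nat}. 1 / real n)"
    using fin by (intro sum_Un_le) (auto simp: Bad_def)
  also have "\<dots> \<le> (\<Sum>n\<in>light \<inter> {..N}. 1 / real n) + (\<Sum>n\<in>Bad. 1 / real n)
      + (\<Sum>n\<in>{1,3,5,7::nat}. 1 / real n)"
    using fin by (intro add_right_mono sum_Un_le) (auto simp: Bad_def)
  finally have "h / 2 - 2 \<le> (\<Sum>n\<in>light \<inter> {..N}. 1 / real n)"
    using bad by simp
  moreover have "ln (real N) / 2 \<le> h"
    using sum_odd_reciprocals_ge[OF assms] by (simp add: h_def O'_def)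
  ultimately show ?thesis
    by linarith
qed

lemma harm_le_ln:
  assumes "M \<ge> 1"
  shows "harm M \<le> ln (real M) + (1 :: real)"
  using euler_mascheroni_sequence_decreasing[of 1 M] assms by (simp add: harm_def)

text \<open>Elements up to \<open>M\<close> give at most \<open>harm M\<close>; the at most
  \<open>M\<close> larger ones give at most \<open>1 / M\<close> each. This prices the orders whose
  primes are already in use.\<close>

lemma sum_reciprocals_le:
  assumes "finite E" "0 \<notin> E" "card E \<le> M" "M \<ge> 1"
  shows "(\<Sum>n\<in>E. 1 / real n) \<le> ln (real M) + 2"
proof -
  have "(\<Sum>n\<in>E. 1 / real n) = (\<Sum>n\<in>E \<inter> {..M}. 1 / real n) + (\<Sum>n\<in>E - {..M}. 1 / real n)"
    using assms(1) by (rule sum.Int_Diff)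
  also have "(\<Sum>n\<in>E \<inter> {..M}. 1 / real n) \<le> harm M"
    unfolding harm_def inverse_eq_divide
    using assms(2) by (intro sum_mono2) (auto simp: Suc_le_eq intro: ccontr)
  also have "(\<Sum>n\<in>E - {..M}. 1 / real n) \<le> (\<Sum>n\<in>E - {..M}. 1 / real M)"
    using assms(4) by (intro sum_mono frac_le) auto
  also have "\<dots> = real (card (E - {..M})) / real M"
    by simp
  also have "\<dots> \<le> 1"
    using assms card_mono[of E "E - {..M}"] by (simp add: divide_le_eq_1)
  finally show ?thesis
    using harm_le_ln[OF assms(4)] by linarith
qed

text \<open>Treating the moduli one at a time, the fullest class modulo \<open>n\<close> contains at
  least a proportion \<open>1 / n\<close> of what is still uncovered, and
  \<open>1 - 1 / n \<le> exp (- 1 / n)\<close>.\<close>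

lemma greedy_covering:
  fixes H D :: "nat set"
  assumes "finite D" "finite H" "0 \<notin> D"
  shows "\<exists>c. real (card {h \<in> H. \<forall>n\<in>D. \<not> [h = c n] (mod n)})
    \<le> real (card H) * exp (- (\<Sum>n\<in>D. 1 / real n))"
  using assms(1,3)
proof (induction D rule: finite_induct)
  case (insert n D)
  then obtain c where c: "real (card {h \<in> H. \<forall>n\<in>D. \<not> [h = c n] (mod n)})
      \<le> real (card H) * exp (- (\<Sum>n\<in>D. 1 / real n))"
    by auto
  define U where "U = {h \<in> H. \<forall>n\<in>D. \<not> [h = c n] (mod n)}"
  have n: "n > 0"
    using insert.prems by auto
  have finU: "finite U"
    using assms(2) by (simp add: U_def)
  \<comment> \<open>Pigeonhole over the \<open>n\<close> residue classes that partition
    \<open>U\<close>.\<close>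
  have "\<exists>r<n. real (card U) / real n \<le> real (card {h \<in> U. h mod n = r})"
  proof (rule ccontr)
    assume "\<not> ?thesis"
    then have "(\<Sum>r<n. real (card {h \<in> U. h mod n = r})) < (\<Sum>r<n. real (card U) / real n)"
      using n by (intro sum_strict_mono) auto
    moreover have "(\<Sum>r<n. card {h \<in> U. h mod n = r}) = card U"
      using sum.group[of U "{..<n}" "\<lambda>h. h mod n" "\<lambda>_. 1::nat"] finU n
      by (simp add: image_subset_iff)
    ultimately show False
      using n by (simp flip: of_nat_sum)
  qed
  then obtain r where r: "r < n" "real (card U) / real n \<le> real (card {h \<in> U. h mod n = r})"
    by blast
  define c' where "c' = c(n := r)"
  have "{h \<in> H. \<forall>m\<in>insert n D. \<not> [h = c' m] (mod m)} = U - {h \<in> U. h mod n = r}"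
    using insert.hyps(2) r(1)
    by (auto simp: c'_def U_def unique_euclidean_semiring_class.cong_def)
  then have "real (card {h \<in> H. \<forall>m\<in>insert n D. \<not> [h = c' m] (mod m)})
      = real (card U) - real (card {h \<in> U. h mod n = r})"
    using finU by (simp add: card_Diff_subset of_nat_diff card_mono)
  also have "\<dots> \<le> real (card U) * (1 + (- 1 / real n))"
    using r(2) by (simp add: algebra_simps)
  also have "\<dots> \<le> real (card U) * exp (- 1 / real n)"
    by (intro mult_left_mono exp_ge_add_one_self) auto
  also have "\<dots> \<le> real (card H) * exp (- (\<Sum>n\<in>D. 1 / real n)) * exp (- 1 / real n)"
    using c by (intro mult_right_mono) (auto simp: U_def)
  also have "\<dots> = real (card H) * exp (- (\<Sum>n\<in>insert n D. 1 / real n))"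
    using insert.hyps by (simp add: exp_add[symmetric])
  finally show ?case
    by blast
qed auto

section \<open>A lower bound for the number of primes\<close>

text \<open>The recursion behind the induction is that of the Leibniz harmonic triangle.\<close>

lemma mult_binomial_dvd_Lcm:
  fixes n k :: nat
  assumes "k \<le> n" "n \<le> N"
  shows "Suc n * (n choose k) dvd Lcm {1..Suc N}"
  using assms
proof (induction k arbitrary: n)
  case 0
  then show ?case
    by (auto intro!: dvd_Lcm)
next
  case (Suc k)
  define d where "d = Lcm {1..Suc N}"
  obtain m where n: "n = Suc m"
    using Suc.prems by (cases n) auto
  have km: "k \<le> m"
    using Suc.prems n by simp
  then have nk: "int n = int k + int (n - k)"
    using n by simp
  obtain x where x: "d = Suc n * (n choose k) * x"
    using Suc.IH[of n] Suc.prems by (auto simp: d_def elim!: dvdE)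
  obtain y where y: "d = n * (m choose k) * y"
    using Suc.IH[of m] Suc.prems n by (auto simp: d_def elim!: dvdE)
  have b1: "Suc k * (n choose Suc k) = n * (m choose k)"
    unfolding n using Suc_times_binomial_eq[of m k] by (simp add: mult_ac)
  have b2: "(n - k) * (n choose k) = n * (m choose k)"
    unfolding n using binomial_absorb_comp[of "Suc m" k] by simp
  \<comment> \<open>The Leibniz rule says that \<open>1 / (Suc n * (n choose Suc k))\<close> is the
    difference of the reciprocals of \<open>n * (m choose k)\<close> and
    \<open>Suc n * (n choose k)\<close>. Multiplied by \<open>d\<close>, it exhibits the cofactor
    \<open>y - x\<close>.\<close>
  have "int (Suc k) * (int (Suc n * (n choose Suc k)) * (int y - int x))
      = int (Suc n) * int (Suc k * (n choose Suc k)) * (int y - int x)"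
    by (simp add: algebra_simps)
  also have "\<dots> = int (Suc n) * int (n * (m choose k) * y)
      - int (Suc n) * int ((n - k) * (n choose k)) * int x"
    unfolding b1 b2 by (simp add: algebra_simps)
  also have "\<dots> = int (Suc n) * int d - int (n - k) * int (Suc n * (n choose k) * x)"
    unfolding y of_nat_mult by (simp add: algebra_simps)
  also have "\<dots> = int (Suc k) * int d"
    unfolding x[symmetric] of_nat_Suc by (subst nk) (simp add: algebra_simps)
  finally have "int (Suc n * (n choose Suc k)) * (int y - int x) = int d"
    by simp
  then have "int (Suc n * (n choose Suc k)) dvd int d"
    by (metis dvd_triv_left)
  then show ?case
    unfolding d_def by (simp only: int_dvd_int_iff)
qed

text \<open>Each of the \<open>N + 1\<close> divisors \<open>Suc N * (N choose k)\<close> is at most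
  the Lcm, and the binomial row sums to \<open>2 ^ N\<close>.\<close>

lemma two_power_le_Lcm: "2 ^ N \<le> Lcm {1..Suc N}"
proof -
  have pos: "Lcm {1..Suc N} > 0"
    by (intro Nat.gr0I) (simp add: Lcm_0_iff)
  have "Suc N * 2 ^ N = (\<Sum>k\<le>N. Suc N * (N choose k))"
    by (simp only: choose_row_sum sum_distrib_left[symmetric])
  also have "\<dots> \<le> (\<Sum>k\<le>N. Lcm {1..Suc N})"
  proof (rule sum_mono)
    fix k assume "k \<in> {..N}"
    then show "Suc N * (N choose k) \<le> Lcm {1..Suc N}"
      using pos mult_binomial_dvd_Lcm[of k N N] by (intro dvd_imp_le) auto
  qed
  also have "\<dots> = Suc N * Lcm {1..Suc N}"
    by simp
  finally show ?thesis
    by (simp only: Suc_mult_le_cancel1)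
qed

lemma Lcm_le_power_prime_count:
  fixes N :: nat
  shows "Lcm {1..N} \<le> N ^ card {p. prime p \<and> p \<le> N}"
proof (cases "N = 0")
  case True
  then have "{p. prime p \<and> p \<le> N} = {}"
    by auto
  then show ?thesis
    by (simp only: True) simp
next
  case False
  define P where "P = {p. prime p \<and> p \<le> N}"
  \<comment> \<open>The exponent of \<open>p\<close> in the Lcm. The prime power
    \<open>p ^ e p\<close> divides some number up to \<open>N\<close>, so each prime contributes at
    most a factor \<open>N\<close>.\<close>
  define e where "e p = Max (multiplicity p ` {1..N})" for p
  have P: "finite P" "0 \<notin> P"
    by (auto simp: P_def)
  have le: "p ^ e p \<le> N" if "p \<in> P" for p
  proof -
    have "e p \<in> multiplicity p ` {1..N}"
      unfolding e_def using False by (intro Max_in) auto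
    then obtain i where i: "i \<in> {1..N}" "e p = multiplicity p i"
      by auto
    have "p ^ e p \<le> i"
      using i by (intro dvd_imp_le) (auto simp: multiplicity_dvd)
    then show ?thesis
      using i by simp
  qed
  have "Lcm {1..N} dvd (\<Prod>p\<in>P. p ^ e p)"
  proof (rule Lcm_least)
    fix i assume i: "i \<in> {1..N}"
    then have "i = (\<Prod>p\<in>prime_factors i. p ^ multiplicity p i)"
      by (simp add: prod_prime_factors)
    also have "\<dots> dvd (\<Prod>p\<in>prime_factors i. p ^ e p)"
      using i by (intro prod_dvd_prod le_imp_power_dvd) (auto simp: e_def)
    also have "\<dots> dvd (\<Prod>p\<in>P. p ^ e p)"
      using i P by (intro prod_dvd_prod_subset)
        (auto simp: P_def in_prime_factors_iff dest!: dvd_imp_le)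
    finally show "i dvd (\<Prod>p\<in>P. p ^ e p)" .
  qed
  then have "Lcm {1..N} \<le> (\<Prod>p\<in>P. p ^ e p)"
    using P by (intro dvd_imp_le) (auto simp: prod_pos_nat_iff intro: gr0I)
  also have "\<dots> \<le> (\<Prod>p\<in>P. N)"
    using le by (intro prod_mono) auto
  finally show ?thesis
    by (simp add: P_def)
qed

text \<open>A Chebyshev-type bound, from comparing the two estimates for the Lcm. It will supply the
  small primes for the exponents that the greedy covering misses.\<close>

lemma prime_count_ge:
  assumes "N \<ge> 1"
  shows "real (N - 1) * ln 2 \<le> real (card {p. prime p \<and> p \<le> N}) * ln (real N)"
proof -
  have "2 ^ (N - 1) \<le> N ^ card {p. prime p \<and> p \<le> N}"
    using two_power_le_Lcm[of "N - 1"] Lcm_le_power_prime_count[of N] assms by simp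
  then have "real (2 ^ (N - 1)) \<le> real (N ^ card {p. prime p \<and> p \<le> N})"
    by (simp only: of_nat_le_iff)
  then have "ln (2 ^ (N - 1) :: real) \<le> ln (real N ^ card {p. prime p \<and> p \<le> N})"
    using assms by (subst ln_le_cancel_iff) simp_all
  then show ?thesis
    using assms by (simp add: ln_realpow)
qed

section \<open>Covering all exponents\<close>

text \<open>Greedy covering by light orders up to \<open>N\<close>, each realised by a primitive
  prime. Their harmonic sum is at least \<open>ln N / 4 - 2\<close>, and avoiding \<open>P\<close>
  costs at most \<open>ln M + 2\<close>; the hypothesis on \<open>N\<close> leaves at least
  \<open>L\<close>.\<close>

lemma one_base_covering:
  fixes a M N :: nat and H P :: "nat set" and L :: real
  assumes a: "a \<ge> 2" and fin: "finite H" "finite P"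
    and M: "card P \<le> M" "M \<ge> 1" and N: "N \<ge> 1" "4 * (L + ln (real M) + 4) \<le> ln (real N)"
  shows "\<exists>S e. finite S \<and> S \<inter> P = {} \<and> card S \<le> N \<and> (\<forall>p\<in>S. prime p \<and> p \<le> a ^ N) \<and>
    real (card {h \<in> H. \<forall>p\<in>S. \<not> [a ^ h = a ^ e p] (mod p)}) \<le> real (card H) * exp (- L)"
proof -
  have "\<forall>n\<in>light. \<exists>p. prime p \<and> p dvd a ^ n - 1 \<and> (\<forall>m. 0 < m \<and> m < n \<longrightarrow> \<not> p dvd a ^ m - 1)"
    using exists_primitive_prime[OF a] by (auto simp: light_def)
  then obtain \<pi> where \<pi>: "\<And>n. n \<in> light \<Longrightarrow> prime (\<pi> n)"
      "\<And>n. n \<in> light \<Longrightarrow> \<pi> n dvd a ^ n - 1"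
      "\<And>n m. n \<in> light \<Longrightarrow> 0 < m \<Longrightarrow> m < n \<Longrightarrow> \<not> \<pi> n dvd a ^ m - 1"
    unfolding bchoice_iff by blast
  have pos: "n > 0" if "n \<in> light" for n
    using that by (auto simp: light_def)
  \<comment> \<open>The order of \<open>a\<close> modulo \<open>\<pi> n\<close> is exactly
    \<open>n\<close>, so the prime determines the order. Hence \<open>P\<close> spoils at most
    \<open>card P\<close> orders.\<close>
  have inj: "inj_on \<pi> light"
  proof (rule inj_onI)
    fix m n assume mn: "m \<in> light" "n \<in> light" "\<pi> m = \<pi> n"
    then show "m = n"
      using \<pi>(2)[of m] \<pi>(2)[of n] \<pi>(3)[of m n] \<pi>(3)[of n m] pos by (metis linorder_neqE_nat)
  qed
  define D0 where "D0 = light \<inter> {..N}"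
  define E where "E = {n \<in> D0. \<pi> n \<in> P}"
  define D where "D = D0 - E"
  have finD: "finite D0" "finite E" "finite D"
    by (auto simp: D0_def E_def D_def)
  have "card E \<le> card P"
    using fin inj by (intro card_inj_on_le[of \<pi>]) (auto simp: E_def D0_def inj_on_def)
  then have "(\<Sum>n\<in>E. 1 / real n) \<le> ln (real M) + 2"
    using finD M pos by (intro sum_reciprocals_le) (auto simp: E_def D0_def)
  moreover have "(\<Sum>n\<in>D. 1 / real n) = (\<Sum>n\<in>D0. 1 / real n) - (\<Sum>n\<in>E. 1 / real n)"
    unfolding D_def using finD by (intro sum_diff) (auto simp: E_def)
  moreover have "ln (real N) / 4 - 2 \<le> (\<Sum>n\<in>D0. 1 / real n)"
    using sum_light_reciprocals_ge[OF N(1)] by (simp add: D0_def)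
  moreover have "L + ln (real M) + 4 \<le> ln (real N) / 4"
    using N(2) by simp
  ultimately have sumD: "L \<le> (\<Sum>n\<in>D. 1 / real n)"
    by linarith
  have "0 \<notin> D"
    using pos by (auto simp: D_def D0_def)
  then obtain c where c: "real (card {h \<in> H. \<forall>n\<in>D. \<not> [h = c n] (mod n)})
      \<le> real (card H) * exp (- (\<Sum>n\<in>D. 1 / real n))"
    using greedy_covering[OF finD(3) fin(1)] by blast
  have injD: "inj_on \<pi> D"
    using inj by (rule inj_on_subset) (auto simp: D_def D0_def)
  define e where "e p = c (inv_into D \<pi> p)" for p
  have e: "e (\<pi> n) = c n" if "n \<in> D" for n
    using injD that by (simp add: e_def)
  have "card D \<le> card {1..N}"
    using pos by (intro card_mono) (auto simp: D_def D0_def Suc_le_eq)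
  then have card_S: "card (\<pi> ` D) \<le> N"
    using card_image_le[OF finD(3), of \<pi>] by simp
  \<comment> \<open>Since \<open>a ^ n\<close> is 1 modulo \<open>\<pi> n\<close>, a residue class
    of exponents modulo \<open>n\<close> becomes a single value of \<open>a ^ h\<close> modulo that
    prime.\<close>
  have "{h \<in> H. \<forall>p\<in>\<pi> ` D. \<not> [a ^ h = a ^ e p] (mod p)} \<subseteq> {h \<in> H. \<forall>n\<in>D. \<not> [h = c n] (mod n)}"
  proof clarsimp
    fix h n assume n: "n \<in> D" "[h = c n] (mod n)"
      and not: "\<forall>n\<in>D. \<not> [a ^ h = a ^ e (\<pi> n)] (mod \<pi> n)"
    have nl: "n \<in> light"
      using n by (auto simp: D_def D0_def)
    have one: "[a ^ n = 1] (mod \<pi> n)"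
      using \<pi>(2)[OF nl] a by (simp add: cong_altdef_nat)
    have red: "[a ^ k = a ^ (k mod n)] (mod \<pi> n)" for k
    proof -
      have "a ^ k = (a ^ n) ^ (k div n) * a ^ (k mod n)"
        by (simp flip: power_mult power_add)
      also have "[\<dots> = 1 ^ (k div n) * a ^ (k mod n)] (mod \<pi> n)"
        by (intro cong_mult cong_pow one cong_refl)
      finally show ?thesis
        by simp
    qed
    have "h mod n = c n mod n"
      using n by (simp add: unique_euclidean_semiring_class.cong_def)
    then have "[a ^ h = a ^ c n] (mod \<pi> n)"
      using red[of h] red[of "c n"] by (metis cong_sym cong_trans)
    then show False
      using not n e by auto
  qed
  then have "real (card {h \<in> H. \<forall>p\<in>\<pi> ` D. \<not> [a ^ h = a ^ e p] (mod p)})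
      \<le> real (card {h \<in> H. \<forall>n\<in>D. \<not> [h = c n] (mod n)})"
    using fin(1) by (intro of_nat_mono card_mono) auto
  also have "\<dots> \<le> real (card H) * exp (- L)"
    using c sumD by (elim order.trans) (intro mult_left_mono, auto)
  finally have "real (card {h \<in> H. \<forall>p\<in>\<pi> ` D. \<not> [a ^ h = a ^ e p] (mod p)})
      \<le> real (card H) * exp (- L)" .
  moreover have "p \<le> a ^ N" if "p \<in> \<pi> ` D" for p
  proof -
    obtain n where n: "n \<in> light" "n \<le> N" "p = \<pi> n"
      using \<open>p \<in> \<pi> ` D\<close> by (auto simp: D_def D0_def)
    have "a ^ n > 1"
      using a pos[OF n(1)] one_less_power[of a n] by simp
    then have "p \<le> a ^ n - 1"
      using \<pi>(2)[OF n(1)] n(3) by (intro dvd_imp_le) auto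
    also have "\<dots> \<le> a ^ N"
      using a n(2) by (intro order.trans[OF diff_le_self power_increasing]) auto
    finally show ?thesis .
  qed
  moreover have "\<pi> ` D \<inter> P = {}"
    by (auto simp: D_def E_def)
  moreover have "prime p" if "p \<in> \<pi> ` D" for p
    using that \<pi>(1) by (auto simp: D_def D0_def)
  ultimately show ?thesis
    using finD(3) card_S by (intro exI[of _ "\<pi> ` D"] exI[of _ e]) auto
qed

text \<open>A prime serving an earlier family can spoil at most one order for the next one, and spoiling
  \<open>M\<close> orders costs at most \<open>ln M + 2\<close> in the harmonic sum; hence the exponential growth of the
  logarithm of the bound with the number of families.\<close>

lemma almost_covering:
  fixes F :: "'f set" and \<alpha> :: "'f \<Rightarrow> nat" and H P :: "nat set" and A L :: real
  assumes "finite F" and \<alpha>: "\<forall>f\<in>F. 2 \<le> \<alpha> f \<and> \<alpha> f \<le> K"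
    and fin: "finite H" "finite P" and A: "A \<ge> 1" "L + 4 \<le> A"
    and card_P: "real (card P) \<le> exp A"
  shows "\<exists>S \<phi> e. finite S \<and> S \<inter> P = {} \<and> real (card (P \<union> S)) \<le> exp (A * 16 ^ card F) \<and>
    (\<forall>p\<in>S. prime p \<and> \<phi> p \<in> F \<and> ln (real p) \<le> exp (A * 16 ^ card F) * ln (real K)) \<and>
    (\<forall>f\<in>F. real (card {h \<in> H. \<forall>p\<in>S. \<phi> p = f \<longrightarrow> \<not> [\<alpha> f ^ h = \<alpha> f ^ e p] (mod p)})
      \<le> real (card H) * exp (- L))"
  using assms(1) \<alpha>
proof (induction F rule: finite_induct)
  case empty
  then show ?case
    using card_P by (intro exI[of _ "{}"]) auto
next
  case (insert f F)
  define B where "B = A * 16 ^ card F"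
  have \<alpha>F: "\<forall>f\<in>F. 2 \<le> \<alpha> f \<and> \<alpha> f \<le> K"
    using insert.prems by simp
  obtain S \<phi> e where S: "finite S" "S \<inter> P = {}" "real (card (P \<union> S)) \<le> exp B"
      "\<forall>p\<in>S. prime p \<and> \<phi> p \<in> F \<and> ln (real p) \<le> exp B * ln (real K)"
      "\<forall>f\<in>F. real (card {h \<in> H. \<forall>p\<in>S. \<phi> p = f \<longrightarrow> \<not> [\<alpha> f ^ h = \<alpha> f ^ e p] (mod p)})
        \<le> real (card H) * exp (- L)"
    using insert.IH[OF \<alpha>F, folded B_def] by (elim exE conjE) (rule that)
  have f: "2 \<le> \<alpha> f" "\<alpha> f \<le> K"
    using insert.prems by auto
  have "B \<ge> A"
    using A mult_left_mono[of 1 "16 ^ card F" A] by (simp add: B_def)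
  then have B: "B \<ge> A" "B \<ge> 1"
    using A by auto
  have B': "A * 16 ^ card (insert f F) = 16 * B"
    using insert.hyps by (simp add: B_def)
  \<comment> \<open>\<open>M\<close> bounds the primes already in use. As
    \<open>L + ln M + 4 \<le> 2 * B\<close>, the choice \<open>ln N \<ge> 8 * B\<close> suffices for
    the next family. Doubling the exponent to \<open>16 * B\<close> absorbs the sum
    \<open>exp B + N\<close>, whence the base 16.\<close>
  define M where "M = nat \<lfloor>exp B\<rfloor>"
  define N where "N = nat \<lceil>exp (8 * B)\<rceil>"
  have expB: "exp B \<ge> 1"
    using B by simp
  have M: "card (P \<union> S) \<le> M" "M \<ge> 1"
    using S(3) expB by (auto simp: M_def le_nat_floor)
  have "real M \<le> exp B"
    by (simp add: M_def)
  then have lnM: "ln (real M) \<le> B"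
    using M(2) ln_mono[of "real M" "exp B"] by simp
  have Nge: "exp (8 * B) \<le> real N"
    by (simp add: N_def)
  have N1: "N \<ge> 1"
    using Nge exp_gt_zero[of "8 * B"] by (cases N) auto
  have "8 * B \<le> ln (real N)"
    using Nge N1 by (simp add: ln_ge_iff)
  moreover have "L + ln (real M) + 4 \<le> 2 * B"
    using lnM A(2) B by linarith
  ultimately have lnN: "4 * (L + ln (real M) + 4) \<le> ln (real N)"
    by simp
  have "real N \<le> exp (8 * B) + 1"
    using exp_ge_zero[of "8 * B"] unfolding N_def by linarith
  moreover have "exp B \<le> exp (8 * B)" "1 \<le> exp (8 * B)"
    using B by auto
  ultimately have "exp B + real N \<le> 3 * exp (8 * B)"
    by linarith
  also have "\<dots> \<le> exp (8 * B) * exp (8 * B)"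
  proof (rule mult_right_mono)
    show "3 \<le> exp (8 * B)"
      using exp_ge_add_one_self[of "8 * B"] B by linarith
  qed simp
  also have "exp (8 * B) * exp (8 * B) = exp (16 * B)"
    by (simp flip: exp_add)
  finally have sumMN: "exp B + real N \<le> exp (16 * B)" .
  obtain S' e' where S': "finite S'" "S' \<inter> (P \<union> S) = {}" "card S' \<le> N"
      "\<And>p. p \<in> S' \<Longrightarrow> prime p \<and> p \<le> \<alpha> f ^ N"
      "real (card {h \<in> H. \<forall>p\<in>S'. \<not> [\<alpha> f ^ h = \<alpha> f ^ e' p] (mod p)}) \<le> real (card H) * exp (- L)"
    using one_base_covering[OF f(1) fin(1) _ M N1 lnN] fin(2) S(1) by auto
  \<comment> \<open>\<open>S'\<close> is disjoint from \<open>S\<close>, so the new labels leave the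
    coverings of the earlier families intact.\<close>
  define \<psi> where "\<psi> p = (if p \<in> S' then f else \<phi> p)" for p
  define \<epsilon> where "\<epsilon> p = (if p \<in> S' then e' p else e p)" for p
  have lnK: "ln (real K) \<ge> 0"
    using f by simp
  have "real (card (P \<union> (S \<union> S'))) \<le> exp (16 * B)"
  proof -
    have "card (P \<union> (S \<union> S')) \<le> card (P \<union> S) + card S'"
      using card_Un_le[of "P \<union> S" S'] by (simp add: Un_assoc)
    then show ?thesis
      using S(3) S'(3) sumMN by linarith
  qed
  moreover have "prime p \<and> \<psi> p \<in> insert f F \<and> ln (real p) \<le> exp (16 * B) * ln (real K)"
    if p: "p \<in> S \<union> S'" for p
  proof (cases "p \<in> S'")
    case True
    then have "p \<le> K ^ N" "prime p"
      using S'(4) f power_mono[of "\<alpha> f" K N] by (auto intro: order.trans)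
    have "real p \<le> real K ^ N"
      using \<open>p \<le> K ^ N\<close> by (simp flip: of_nat_power)
    then have "ln (real p) \<le> real N * ln (real K)"
      using f \<open>prime p\<close> by (subst ln_realpow[symmetric]) (auto simp: prime_gt_0_nat)
    also have "\<dots> \<le> exp (16 * B) * ln (real K)"
    proof (rule mult_right_mono[OF _ lnK])
      show "real N \<le> exp (16 * B)"
        using sumMN expB by linarith
    qed
    finally show ?thesis
      using True \<open>prime p\<close> by (simp add: \<psi>_def)
  next
    case False
    then have "p \<in> S"
      using p by simp
    then have "ln (real p) \<le> exp B * ln (real K)" "prime p" "\<phi> p \<in> F"
      using S(4) by auto
    moreover have "exp B * ln (real K) \<le> exp (16 * B) * ln (real K)"
      using B lnK by (intro mult_right_mono) auto
    ultimately show ?thesis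
      using False by (simp add: \<psi>_def)
  qed
  moreover have "real (card {h \<in> H. \<forall>p\<in>S \<union> S'. \<psi> p = g \<longrightarrow> \<not> [\<alpha> g ^ h = \<alpha> g ^ \<epsilon> p] (mod p)})
      \<le> real (card H) * exp (- L)" if g: "g \<in> insert f F" for g
  proof (cases "g = f")
    case True
    have "{h \<in> H. \<forall>p\<in>S \<union> S'. \<psi> p = g \<longrightarrow> \<not> [\<alpha> g ^ h = \<alpha> g ^ \<epsilon> p] (mod p)}
        \<subseteq> {h \<in> H. \<forall>p\<in>S'. \<not> [\<alpha> f ^ h = \<alpha> f ^ e' p] (mod p)}"
      using True by (auto simp: \<psi>_def \<epsilon>_def)
    then show ?thesis
      using S'(5) fin(1) by (elim order.trans[rotated]) (intro of_nat_mono card_mono, auto)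
  next
    case False
    then have "g \<in> F"
      using g by simp
    have "{h \<in> H. \<forall>p\<in>S \<union> S'. \<psi> p = g \<longrightarrow> \<not> [\<alpha> g ^ h = \<alpha> g ^ \<epsilon> p] (mod p)}
        \<subseteq> {h \<in> H. \<forall>p\<in>S. \<phi> p = g \<longrightarrow> \<not> [\<alpha> g ^ h = \<alpha> g ^ e p] (mod p)}"
      using S'(2) by (auto simp: \<psi>_def \<epsilon>_def split: if_splits)
    then show ?thesis
      using bspec[OF S(5) \<open>g \<in> F\<close>] fin(1)
      by (elim order.trans[rotated]) (intro of_nat_mono card_mono, auto)
  qed
  ultimately show ?case
    unfolding B' using S(1,2) S'(1,2)
    by (intro exI[of _ "S \<union> S'"] exI[of _ \<psi>] exI[of _ \<epsilon>]) auto
qed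

text \<open>The almost covering leaves few pairs \<open>(f, h)\<close>, and each receives its own
  prime up to \<open>Q\<close>. The cost is at most \<open>X\<close> primes of logarithm at most
  \<open>X * ln K\<close>, plus \<open>ln Q\<close> for each leftover pair.\<close>

lemma full_covering:
  fixes F :: "'f set" and \<alpha> :: "'f \<Rightarrow> nat" and H P :: "nat set" and A L :: real
  assumes finF: "finite F" and \<alpha>: "\<forall>f\<in>F. 2 \<le> \<alpha> f \<and> \<alpha> f \<le> K"
    and fin: "finite H" "finite P" and A: "A \<ge> 1" "L \<ge> 0" "L + 4 \<le> A"
    and card_P: "real (card P) \<le> exp A"
    and Q: "exp (A * 16 ^ card F) + real (card F) * real (card H)
      \<le> real (card {p. prime p \<and> p \<le> Q})" and K: "K \<ge> 1"
  shows "\<exists>S \<phi> e. finite S \<and> S \<inter> P = {} \<and> (\<forall>p\<in>S. prime p \<and> \<phi> p \<in> F) \<and>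
    (\<forall>f\<in>F. \<forall>h\<in>H. \<exists>p\<in>S. \<phi> p = f \<and> [\<alpha> f ^ h = \<alpha> f ^ e p] (mod p)) \<and>
    (\<Sum>p\<in>S. ln (real p)) \<le> (exp (A * 16 ^ card F))\<^sup>2 * ln (real K)
      + real (card F) * real (card H) * exp (- L) * ln (real Q)"
proof -
  define X where "X = exp (A * 16 ^ card F)"
  obtain S \<phi> e where S: "finite S" "S \<inter> P = {}" "real (card (P \<union> S)) \<le> X"
      "\<forall>p\<in>S. prime p \<and> \<phi> p \<in> F \<and> ln (real p) \<le> X * ln (real K)"
      "\<forall>f\<in>F. real (card {h \<in> H. \<forall>p\<in>S. \<phi> p = f \<longrightarrow> \<not> [\<alpha> f ^ h = \<alpha> f ^ e p] (mod p)})
        \<le> real (card H) * exp (- L)"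
    using almost_covering[of F \<alpha> K H P A L, OF finF \<alpha> fin A(1,3) card_P, folded X_def]
    by (elim exE conjE) (rule that)
  define U where "U f = {h \<in> H. \<forall>p\<in>S. \<phi> p = f \<longrightarrow> \<not> [\<alpha> f ^ h = \<alpha> f ^ e p] (mod p)}" for f
  define W where "W = Sigma F U"
  have finU: "finite (U f)" for f
    using fin by (simp add: U_def)
  have finW: "finite W"
    using finF finU by (simp add: W_def)
  have "real (card W) = (\<Sum>f\<in>F. real (card (U f)))"
    using finF finU by (simp add: W_def)
  also have "\<dots> \<le> (\<Sum>f\<in>F. real (card H) * exp (- L))"
    using S(5) by (intro sum_mono) (simp add: U_def)
  finally have cardW: "real (card W) \<le> real (card F) * real (card H) * exp (- L)"
    by (simp add: mult.assoc)
  also have "\<dots> \<le> real (card F) * real (card H) * 1"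
    using A by (intro mult_left_mono) auto
  finally have cardW': "real (card W) \<le> real (card F) * real (card H)"
    by simp
  define T where "T = {p. prime p \<and> p \<le> Q} - (P \<union> S)"
  have finT: "finite T"
    by (simp add: T_def)
  have "card {p. prime p \<and> p \<le> Q} \<le> card T + card (P \<union> S)"
    unfolding T_def using S(1) fin(2)
    by (metis diff_card_le_card_Diff finite_UnI le_diff_conv)
  then have "card W \<le> card T"
    using Q cardW' S(3) unfolding X_def by linarith
  \<comment> \<open>Discarding \<open>P\<close> and \<open>S\<close> removes at most
    \<open>X\<close> primes, which the hypothesis on \<open>Q\<close> allows for. The prime
    \<open>\<psi> (f, h)\<close> gets exponent \<open>h\<close> itself, so its congruence is
    trivial.\<close>
  then obtain \<psi> where \<psi>: "\<psi> ` W \<subseteq> T" "inj_on \<psi> W"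
    using card_le_inj[OF finW finT] by blast
  define S' where "S' = \<psi> ` W"
  define \<phi>' where "\<phi>' p = (if p \<in> S' then fst (inv_into W \<psi> p) else \<phi> p)" for p
  define e' where "e' p = (if p \<in> S' then snd (inv_into W \<psi> p) else e p)" for p
  have S': "finite S'" "S' \<inter> (P \<union> S) = {}"
    using \<psi>(1) finW by (auto simp: S'_def T_def)
  have \<psi>': "\<phi>' (\<psi> (f, h)) = f" "e' (\<psi> (f, h)) = h" if "(f, h) \<in> W" for f h
    using that \<psi>(2) by (auto simp: \<phi>'_def e'_def S'_def)
  have prime_S': "prime p \<and> \<phi>' p \<in> F \<and> p \<le> Q" if "p \<in> S'" for p
  proof -
    obtain f h where fh: "(f, h) \<in> W" "p = \<psi> (f, h)"
      using \<open>p \<in> S'\<close> by (auto simp: S'_def)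
    then have "p \<in> T"
      using \<psi>(1) by auto
    then show ?thesis
      using fh \<psi>'(1)[OF fh(1)] by (auto simp: T_def W_def)
  qed
  have "\<exists>p\<in>S \<union> S'. \<phi>' p = f \<and> [\<alpha> f ^ h = \<alpha> f ^ e' p] (mod p)" if "f \<in> F" "h \<in> H" for f h
  proof (cases "h \<in> U f")
    case True
    then have "(f, h) \<in> W"
      using that by (simp add: W_def)
    then show ?thesis
      using \<psi>'[of f h] by (intro bexI[of _ "\<psi> (f, h)"]) (auto simp: S'_def)
  next
    case False
    then obtain p where "p \<in> S" "\<phi> p = f" "[\<alpha> f ^ h = \<alpha> f ^ e p] (mod p)"
      using \<open>h \<in> H\<close> by (auto simp: U_def)
    then show ?thesis
      using S'(2) by (intro bexI[of _ p]) (auto simp: \<phi>'_def e'_def)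
  qed
  moreover have "prime p \<and> \<phi>' p \<in> F" if "p \<in> S \<union> S'" for p
    using that prime_S' S(4) by (cases "p \<in> S'") (auto simp: \<phi>'_def)
  moreover have "(\<Sum>p\<in>S \<union> S'. ln (real p)) \<le> X\<^sup>2 * ln (real K)
      + real (card F) * real (card H) * exp (- L) * ln (real Q)"
  proof -
    have lnK: "ln (real K) \<ge> 0"
      using K by simp
    have X0: "X \<ge> 0"
      by (simp add: X_def)
    have "real (card S) \<le> X"
      using S(3) card_mono[of "P \<union> S" S] S(1) fin(2) by simp
    have "(\<Sum>p\<in>S. ln (real p)) \<le> (\<Sum>p\<in>S. X * ln (real K))"
      using S(4) by (intro sum_mono) auto
    also have "\<dots> = real (card S) * (X * ln (real K))"
      by simp
    also have "\<dots> \<le> X * (X * ln (real K))"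
      using \<open>real (card S) \<le> X\<close> lnK X0 by (intro mult_right_mono) auto
    finally have 1: "(\<Sum>p\<in>S. ln (real p)) \<le> X\<^sup>2 * ln (real K)"
      by (simp add: power2_eq_square mult.assoc)
    have "(\<Sum>p\<in>S'. ln (real p)) \<le> (\<Sum>p\<in>S'. ln (real Q))"
      using prime_S' by (intro sum_mono) (auto simp: prime_gt_0_nat intro!: ln_mono)
    also have "\<dots> = real (card W) * ln (real Q)"
      using \<psi>(2) by (simp add: S'_def card_image)
    also have "\<dots> \<le> real (card F) * real (card H) * exp (- L) * ln (real Q)"
    proof (rule mult_right_mono[OF cardW])
      show "0 \<le> ln (real Q)"
        using ln_ge_zero[of "real Q"] by (cases Q) auto
    qed
    finally have 2: "(\<Sum>p\<in>S'. ln (real p))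
        \<le> real (card F) * real (card H) * exp (- L) * ln (real Q)" .
    have "(\<Sum>p\<in>S \<union> S'. ln (real p)) = (\<Sum>p\<in>S. ln (real p)) + (\<Sum>p\<in>S'. ln (real p))"
      using S(1) S' by (intro sum.union_disjoint) auto
    with 1 2 show ?thesis
      by linarith
  qed
  ultimately show ?thesis
    unfolding X_def using S(1,2) S'
    by (intro exI[of _ "S \<union> S'"] exI[of _ \<phi>'] exI[of _ e']) auto
qed

section \<open>Residue classes with many prime divisors\<close>

lemma card_residue_class_in_interval_ge:
  fixes W :: nat and n0 :: int and x y :: real
  assumes W: "W > 0"
  shows "(y - x) / real W - 1
    \<le> real (card {n::int. x \<le> real_of_int n \<and> real_of_int n \<le> y \<and> [n = n0] (mod int W)})"
proof -
  define l u where "l = \<lceil>(x - real_of_int n0) / real W\<rceil>" and "u = \<lfloor>(y - real_of_int n0) / real W\<rfloor>"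
  have "(\<lambda>t. n0 + int W * t) ` {l..u}
      \<subseteq> {n. x \<le> real_of_int n \<and> real_of_int n \<le> y \<and> [n = n0] (mod int W)}" (is "_ \<subseteq> ?C")
  proof clarify
    fix t assume t: "t \<in> {l..u}"
    have "(x - real_of_int n0) / real W \<le> real_of_int t" "real_of_int t \<le> (y - real_of_int n0) / real W"
      using t by (auto simp: l_def u_def ceiling_le_iff le_floor_iff)
    then have "x \<le> real_of_int (n0 + int W * t)" "real_of_int (n0 + int W * t) \<le> y"
      using W by (auto simp: field_simps)
    moreover have "[n0 + int W * t = n0] (mod int W)"
      unfolding unique_euclidean_semiring_class.cong_def by (rule mod_mult_self2)
    ultimately show "x \<le> real_of_int (n0 + int W * t) \<and> real_of_int (n0 + int W * t) \<le> y
        \<and> [n0 + int W * t = n0] (mod int W)"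
      by blast
  qed
  moreover have "finite ?C"
    by (rule finite_subset[of _ "{\<lceil>x\<rceil>..\<lfloor>y\<rfloor>}"]) (auto simp: ceiling_le_iff le_floor_iff)
  ultimately have "card ((\<lambda>t. n0 + int W * t) ` {l..u}) \<le> card ?C"
    by (intro card_mono)
  moreover have "inj_on (\<lambda>t. n0 + int W * t) {l..u}"
    using W by (auto simp: inj_on_def)
  ultimately have "card {l..u} \<le> card ?C"
    by (simp add: card_image)
  moreover have "(y - x) / real W - 1 \<le> real (card {l..u})"
  proof -
    have "(y - x) / real W = (y - real_of_int n0) / real W - (x - real_of_int n0) / real W"
      by (simp flip: diff_divide_distrib)
    then have "(y - x) / real W - 1 \<le> real_of_int (u - l + 1)"
      unfolding l_def u_def by linarith
    also have "\<dots> \<le> real (card {l..u})"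
      by simp
    finally show ?thesis .
  qed
  ultimately show ?thesis
    by linarith
qed

lemma exists_linear_residue:
  fixes p :: nat and u v :: int
  assumes "coprime u (int p)" "p > 0"
  shows "\<exists>b::nat. int p dvd int b * u + v"
proof -
  obtain w where w: "[u * w = 1] (mod int p)"
    using cong_solve_coprime_int[OF assms(1)] by blast
  define b where "b = nat ((- v * w) mod int p)"
  have "[int b = - v * w] (mod int p)"
    using assms(2) by (simp add: b_def)
  then have "[int b * u + v = - v * w * u + v] (mod int p)"
    by (intro cong_add cong_mult cong_refl)
  also have "- v * w * u + v = - v * (u * w) + v"
    by simp
  also have "[\<dots> = - v * 1 + v] (mod int p)"
    by (intro cong_add cong_mult cong_refl w)
  finally show ?thesis
    by (auto simp: cong_0_iff)
qed

text \<open>A prime labelled \<open>(a, j, k, s, r)\<close> fixes \<open>n\<close> modulo itself so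
  that it divides the form at exponent \<open>e p\<close>, hence at every \<open>h\<close> with the
  same power of \<open>a\<close>. The Chinese remainder theorem combines the conditions; the copies
  \<open>r < R\<close> give \<open>R\<close> distinct primes.\<close>

lemma exists_residue_class_omega_ge:
  fixes K R p0 :: nat and H S :: "nat set"
    and \<phi> :: "nat \<Rightarrow> nat \<times> nat \<times> nat \<times> int \<times> nat" and e :: "nat \<Rightarrow> nat"
  defines "F \<equiv> {2..K} \<times> {1..K} \<times> {1..K} \<times> {1, - 1} \<times> {..<R}"
  assumes S: "finite S" "\<forall>p\<in>S. prime p \<and> K < p \<and> \<phi> p \<in> F"
    and p0: "prime p0" "K < p0" "p0 \<notin> S"
    and cover: "\<forall>f\<in>F. \<forall>h\<in>H. \<exists>p\<in>S. \<phi> p = f \<and> [fst f ^ h = fst f ^ e p] (mod p)"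
  shows "\<exists>n0. \<forall>n. [n = n0] (mod int (p0 * \<Prod>S)) \<longrightarrow>
    (\<forall>a j k s h. 2 \<le> a \<and> a \<le> K \<and> 1 \<le> j \<and> j \<le> K \<and> 1 \<le> k \<and> k \<le> K \<and> s \<in> {1, - 1} \<and> h \<in> H \<longrightarrow>
      R \<le> omega (n * int j + s * (int a ^ h * int k)))"
proof -
  have cop: "coprime (int u) (int p)" if "prime p" "K < p" "1 \<le> u" "u \<le> K" for u p
  proof -
    have "\<not> p dvd u"
      using that by (auto dest: dvd_imp_le)
    then show ?thesis
      using that by (simp add: coprime_commute prime_imp_coprime)
  qed
  \<comment> \<open>Solvable for \<open>n\<close> modulo \<open>p\<close> because
    \<open>p > K\<close> makes \<open>j\<close> invertible.\<close>
  have "\<forall>p\<in>S. \<exists>b::nat. case \<phi> p of (a, j, k, s, r) \<Rightarrow> int p dvd int b * int j + s * (int a ^ e p * int k)"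
  proof
    fix p assume p: "p \<in> S"
    obtain a j k s r where \<phi>: "\<phi> p = (a, j, k, s, r)"
      by (cases "\<phi> p") auto
    then have "1 \<le> j" "j \<le> K" "prime p" "K < p"
      using S(2) p by (auto simp: F_def)
    then have "\<exists>b::nat. int p dvd int b * int j + s * (int a ^ e p * int k)"
      by (intro exists_linear_residue cop) (auto simp: prime_gt_0_nat)
    then show "\<exists>b::nat. case \<phi> p of (a, j, k, s, r) \<Rightarrow> int p dvd int b * int j + s * (int a ^ e p * int k)"
      by (simp add: \<phi>)
  qed
  then obtain b where b: "\<forall>p\<in>S. case \<phi> p of (a, j, k, s, r) \<Rightarrow>
      int p dvd int (b p) * int j + s * (int a ^ e p * int k)"
    unfolding bchoice_iff by blast
  \<comment> \<open>\<open>p0 dvd n\<close> with \<open>p0 > K\<close> prevents \<open>n j \<plusminus> a\<^sup>h k = 0\<close>.\<close>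
  define b' where "b' = b(p0 := 0)"
  have "\<exists>x. \<forall>p\<in>insert p0 S. [x = b' p] (mod p)"
    using S p0 by (intro chinese_remainder_nat) (auto intro!: primes_coprime)
  then obtain x where x: "\<And>p. p \<in> insert p0 S \<Longrightarrow> [x = b' p] (mod p)"
    by blast
  show ?thesis
  proof (intro exI[of _ "int x"] allI impI)
    fix n :: int and a j k h :: nat and s :: int
    assume n: "[n = int x] (mod int (p0 * \<Prod>S))"
      and "2 \<le> a \<and> a \<le> K \<and> 1 \<le> j \<and> j \<le> K \<and> 1 \<le> k \<and> k \<le> K \<and> s \<in> {1, - 1} \<and> h \<in> H"
    then have asm: "2 \<le> a" "a \<le> K" "1 \<le> j" "j \<le> K" "1 \<le> k" "k \<le> K" "s \<in> {1, - 1}" "h \<in> H"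
      by auto
    define m where "m = n * int j + s * (int a ^ h * int k)"
    have n_cong: "[n = int (b' p)] (mod int p)" if "p \<in> insert p0 S" for p
    proof -
      have "p dvd p0 * \<Prod>S"
        using that S(1) by (auto intro: dvd_mult dvd_prodI[of S _ "\<lambda>p. p", simplified])
      then have "[n = int x] (mod int p)"
        using n cong_dvd_modulus[of n "int x" "int (p0 * \<Prod>S)" "int p"] by (simp only: int_dvd_int_iff)
      also have "[int x = int (b' p)] (mod int p)"
        using x[OF that] by (simp only: cong_int_iff)
      finally show ?thesis .
    qed
    \<comment> \<open>\<open>omega 0\<close> is 0 by default, so prime divisors count only for
      nonzero \<open>m\<close>.\<close>
    have "m \<noteq> 0"
    proof
      assume "m = 0"
      have "int p0 dvd n"
        using n_cong[of p0] by (simp add: b'_def cong_0_iff)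
      then have "int p0 dvd n * int j"
        by simp
      moreover have "int p0 dvd n * int j + s * (int a ^ h * int k)"
        using \<open>m = 0\<close> by (simp flip: m_def)
      ultimately have "int p0 dvd s * (int a ^ h * int k)"
        using dvd_add_right_iff by blast
      then have "int p0 dvd int a ^ h * int k"
        using asm(7) by auto
      moreover have pr: "prime (int p0)"
        using p0 by simp
      ultimately have "int p0 dvd int a ^ h \<or> int p0 dvd int k"
        by (simp only: prime_dvd_mult_iff)
      then have "int p0 dvd int a \<or> int p0 dvd int k"
        using prime_dvd_power[OF pr, of "int a" h] by linarith
      then show False
        using asm p0(2) by (auto dest: dvd_imp_le)
    qed
    have "\<forall>r\<in>{..<R}. \<exists>p. p \<in> S \<and> \<phi> p = (a, j, k, s, r) \<and> [a ^ h = a ^ e p] (mod p)"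
    proof
      fix r assume "r \<in> {..<R}"
      then have "(a, j, k, s, r) \<in> F"
        using asm by (auto simp: F_def)
      from bspec[OF bspec[OF cover this] asm(8)]
      show "\<exists>p. p \<in> S \<and> \<phi> p = (a, j, k, s, r) \<and> [a ^ h = a ^ e p] (mod p)"
        by (simp add: Bex_def)
    qed
    from bchoice[OF this] obtain q where q': "\<forall>r\<in>{..<R}. q r \<in> S \<and> \<phi> (q r) = (a, j, k, s, r)
        \<and> [a ^ h = a ^ e (q r)] (mod q r)" ..
    then have q: "q r \<in> S" "\<phi> (q r) = (a, j, k, s, r)" "[a ^ h = a ^ e (q r)] (mod q r)"
      if "r < R" for r
      using that by auto
    have q_dvd: "int (q r) dvd m" if r: "r < R" for r
    proof -
      let ?p = "q r"
      have "?p \<noteq> p0"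
        using q(1)[OF r] p0 by auto
      then have "[n = int (b ?p)] (mod int ?p)"
        using n_cong[of ?p] q(1)[OF r] by (simp add: b'_def)
      moreover have "[int (a ^ h) = int (a ^ e ?p)] (mod int ?p)"
        using q(3)[OF r] by (simp only: cong_int_iff)
      ultimately have "[m = int (b ?p) * int j + s * (int a ^ e ?p * int k)] (mod int ?p)"
        unfolding m_def of_nat_power by (intro cong_add cong_mult cong_refl)
      moreover have "int ?p dvd int (b ?p) * int j + s * (int a ^ e ?p * int k)"
        using bspec[OF b q(1)[OF r]] q(2)[OF r] by simp
      ultimately show ?thesis
        by (rule cong_dvd_iff[THEN iffD2])
    qed
    \<comment> \<open>The label of a prime records its copy \<open>r\<close>, so different copies
      use different primes.\<close>
    have "inj_on (\<lambda>r. int (q r)) {..<R}"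
    proof (rule inj_onI)
      fix r r' assume r: "r \<in> {..<R}" "r' \<in> {..<R}" "int (q r) = int (q r')"
      then have "\<phi> (q r) = (a, j, k, s, r)" "\<phi> (q r) = (a, j, k, s, r')"
        using q(2)[of r] q(2)[of r'] by (simp_all only: lessThan_iff of_nat_eq_iff)
      then show "r = r'"
        by simp
    qed
    then have "R = card ((\<lambda>r. int (q r)) ` {..<R})"
      by (simp add: card_image)
    also have "\<dots> \<le> omega m"
      unfolding omega_def
    proof (intro card_mono subsetI)
      fix z assume "z \<in> (\<lambda>r. int (q r)) ` {..<R}"
      then obtain r where r: "r < R" "z = int (q r)"
        by blast
      then have "prime (q r)"
        using q(1) S(2) by blast
      then show "z \<in> prime_factors \<bar>m\<bar>"
        using r q_dvd[OF r(1)] \<open>m \<noteq> 0\<close> by (simp add: in_prime_factors_iff)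
    qed simp
    finally show "R \<le> omega (n * int j + s * (int a ^ h * int k))"
      by (simp add: m_def)
  qed
qed

text \<open>Here \<open>L = ln x\<close>. The first condition keeps the number of primes of the greedy covering below
  \<open>L\<^bsup>1/8\<^esup>\<close>, the next two bound the contributions of these and of the remaining primes to \<open>ln W\<close>,
  and the fourth provides enough primes below \<open>L\<^sup>2\<close>.\<close>

definition admissible :: "real \<Rightarrow> real \<Rightarrow> real \<Rightarrow> real \<Rightarrow> real \<Rightarrow> bool" where
  "admissible C K c \<epsilon> L \<longleftrightarrow>
    (2 * ln (ln L) + c) * exp (4 * (C * (ln (ln L) powr (1/3) + 1))) \<le> ln L / 8 \<and>
    L powr (1/4) * ln K \<le> \<epsilon> / 4 * L \<and>
    C * (ln (ln L) powr (1/3) + 1) * (K * L + 1) * exp (- (2 * ln (ln L))) * (2 * ln L) \<le> \<epsilon> / 4 * L \<and>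
    (L powr (1/8) + C * (ln (ln L) powr (1/3) + 1) * (K * L + 1)) * (2 * ln L) \<le> (L\<^sup>2 - 2) * ln 2 \<and>
    1 \<le> ln (ln L) \<and> 2 \<le> L"

text \<open>With \<open>w = ln (ln L)\<close>, the first condition compares
  \<open>exp (O(w powr (1/3)))\<close> with \<open>ln L = exp w\<close>. In the third,
  \<open>exp (- 2 * w)\<close> is \<open>1 / (ln L)^2\<close>, which beats the remaining
  \<open>ln L * w powr (1/3)\<close>.\<close>

lemma eventually_admissible:
  assumes "C > 0" "K > 1" "c > 0" "\<epsilon> > 0"
  shows "eventually (admissible C K c \<epsilon>) at_top"
proof -
  have k: "ln K > 0" "K > 0"
    using assms by auto
  have "\<forall>\<^sub>F L in at_top.
      (2 * ln (ln L) + c) * exp (4 * (C * (ln (ln L) powr (1/3) + 1))) \<le> ln L / 8"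
    using assms(1,3) by real_asymp
  moreover have "\<forall>\<^sub>F L in at_top. L powr (1/4) * ln K \<le> \<epsilon> / 4 * L"
    using k assms(4) by real_asymp
  moreover have "\<forall>\<^sub>F L in at_top. C * (ln (ln L) powr (1/3) + 1) * (K * L + 1)
      * exp (- (2 * ln (ln L))) * (2 * ln L) \<le> \<epsilon> / 4 * L"
    using assms(1,4) k(2) by real_asymp
  moreover have "\<forall>\<^sub>F L in at_top. (L powr (1/8) + C * (ln (ln L) powr (1/3) + 1) * (K * L + 1))
      * (2 * ln L) \<le> (L\<^sup>2 - 2) * ln 2"
    using assms(1) k(2) by real_asymp
  moreover have "\<forall>\<^sub>F L::real in at_top. 1 \<le> ln (ln L)" "\<forall>\<^sub>F L::real in at_top. 2 \<le> L"
    by (real_asymp, rule eventually_ge_at_top)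
  ultimately show ?thesis
    unfolding admissible_def by (intro eventually_conj)
qed

section \<open>Choice of parameters and count of the integers in the residue class\<close>

theorem theorem1p1:
  fixes K :: nat
  assumes "K \<ge> 2"
  shows "\<exists>\<epsilon>0>0. \<forall>\<epsilon>::real. 0 < \<epsilon> \<and> \<epsilon> < \<epsilon>0 \<longrightarrow>
    (\<exists>x0::real. \<forall>x::real. x \<ge> x0 \<longrightarrow>
      real (card {n::int. x \<le> real_of_int n \<and> real_of_int n \<le> (1 + 1 / real K) * x \<and>
         (\<forall>a j k h::nat. 2 \<le> a \<and> a \<le> K \<and> 1 \<le> j \<and> j \<le> K \<and> 1 \<le> k \<and> k \<le> K \<and>
              real h \<le> real K * ln x \<longrightarrow>
            real (omega (n * int j + int a ^ h * int k)) \<ge> (ln (ln (ln x))) powr (1/3 - \<epsilon>) \<and>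
            real (omega (n * int j - int a ^ h * int k)) \<ge> (ln (ln (ln x))) powr (1/3 - \<epsilon>))})
      \<ge> x powr (1 - \<epsilon>))"
proof (rule exI[of _ "1::real"], intro conjI allI impI)
  fix \<epsilon> :: real
  assume "0 < \<epsilon> \<and> \<epsilon> < 1"
  then have \<epsilon>: "0 < \<epsilon>" "\<epsilon> < 1"
    by auto
  obtain p0 :: nat where p0: "prime p0" "K < p0"
    using bigger_prime by blast
  \<comment> \<open>Forbidding all primes up to \<open>p0\<close> makes the covering primes exceed
    \<open>K\<close> and differ from \<open>p0\<close>.\<close>
  define P where "P = {p. prime p \<and> p \<le> p0}"
  have finP: "finite P"
    by (simp add: P_def)
  \<comment> \<open>Chosen so that \<open>A = 2 * w + c\<close> satisfies
    \<open>2 * w + 4 \<le> A\<close> and \<open>card P \<le> exp A\<close>.\<close>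
  define c where "c = 5 + ln (real (card P) + 1)"
  have c: "c \<ge> 5" "ln (real (card P) + 1) \<le> c"
    by (auto simp: c_def)
  \<comment> \<open>There are at most \<open>2 * K^3\<close> choices of \<open>(a, j, k, s)\<close>,
    each needing \<open>R\<close> copies. \<open>D\<close> collects the interval length
    \<open>x / K\<close> and the factor \<open>p0\<close> of the modulus.\<close>
  define C where "C = 2 * real K ^ 3"
  define D where "D = real K * real p0"
  have CD: "C > 0" "D > 0"
    using assms p0 by (auto simp: C_def D_def)
  have "\<forall>\<^sub>F x in at_top. x powr (1 - \<epsilon>) \<le> x powr (1 - \<epsilon> / 2) / D - 1"
    using CD(2) \<epsilon> by real_asymp
  moreover have "\<forall>\<^sub>F x in at_top. admissible C (real K) c \<epsilon> (ln x)"
  proof (rule eventually_compose_filterlim[OF _ ln_at_top])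
    show "eventually (admissible C (real K) c \<epsilon>) at_top"
      using CD(1) assms c(1) \<epsilon>(1) by (intro eventually_admissible) auto
  qed
  ultimately have "\<forall>\<^sub>F x in at_top. (x powr (1 - \<epsilon>) \<le> x powr (1 - \<epsilon> / 2) / D - 1 \<and>
      admissible C (real K) c \<epsilon> (ln x)) \<and> 1 \<le> x"
    by (intro eventually_conj eventually_ge_at_top)
  then obtain x0 where x0: "\<forall>x\<ge>x0. (x powr (1 - \<epsilon>) \<le> x powr (1 - \<epsilon> / 2) / D - 1 \<and>
      admissible C (real K) c \<epsilon> (ln x)) \<and> 1 \<le> x"
    unfolding eventually_at_top_linorder by (elim exE) (rule that)
  show "\<exists>x0::real. \<forall>x::real. x \<ge> x0 \<longrightarrow>
      real (card {n::int. x \<le> real_of_int n \<and> real_of_int n \<le> (1 + 1 / real K) * x \<and>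
         (\<forall>a j k h::nat. 2 \<le> a \<and> a \<le> K \<and> 1 \<le> j \<and> j \<le> K \<and> 1 \<le> k \<and> k \<le> K \<and>
              real h \<le> real K * ln x \<longrightarrow>
            real (omega (n * int j + int a ^ h * int k)) \<ge> (ln (ln (ln x))) powr (1/3 - \<epsilon>) \<and>
            real (omega (n * int j - int a ^ h * int k)) \<ge> (ln (ln (ln x))) powr (1/3 - \<epsilon>))})
      \<ge> x powr (1 - \<epsilon>)"
  proof (intro exI[of _ x0] allI impI)
    fix x :: real
    assume "x \<ge> x0"
    define L where "L = ln x"
    define w where "w = ln (ln L)"
    define y where "y = C * (w powr (1/3) + 1)"
    have b1: "x powr (1 - \<epsilon>) \<le> x powr (1 - \<epsilon> / 2) / D - 1"
      and adm: "admissible C (real K) c \<epsilon> L" and x: "1 \<le> x"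
      unfolding L_def using x0[rule_format, OF \<open>x \<ge> x0\<close>] by blast+
    have b2: "(2 * w + c) * exp (4 * y) \<le> ln L / 8"
      and b3: "L powr (1/4) * ln (real K) \<le> \<epsilon> / 4 * L"
      and b4: "y * (real K * L + 1) * exp (- (2 * w)) * (2 * ln L) \<le> \<epsilon> / 4 * L"
      and b5: "(L powr (1/8) + y * (real K * L + 1)) * (2 * ln L) \<le> (L\<^sup>2 - 2) * ln 2"
      and w: "1 \<le> w" and L: "2 \<le> L"
      using adm unfolding admissible_def w_def y_def by blast+
    have lnL: "ln L > 0"
      using L by simp
    define R where "R = nat \<lceil>w powr (1/3)\<rceil>"
    define F where "F = {2..K} \<times> {1..K} \<times> {1..K} \<times> {1, - 1 :: int} \<times> {..<R}"
    define H where "H = {..nat \<lfloor>real K * L\<rfloor>}"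
    define A where "A = 2 * w + c"
    define Q where "Q = nat \<lfloor>L\<^sup>2\<rfloor>"
    have R: "w powr (1/3) \<le> real R" "real R \<le> w powr (1/3) + 1"
      using powr_ge_zero[of w "1/3"] unfolding R_def by linarith+
    have "real (card F) = real (K - 1) * real K * real K * 2 * real R"
      by (simp add: F_def card_cartesian_product)
    also have "\<dots> \<le> real K * real K * real K * 2 * real R"
      by (intro mult_right_mono) auto
    also have "\<dots> = C * real R"
      by (simp add: C_def power3_eq_cube)
    also have "\<dots> \<le> y"
      unfolding y_def using R(2) CD(1) by (intro mult_left_mono) auto
    finally have cardF: "real (card F) \<le> y" .
    have cardH: "real (card H) \<le> real K * L + 1"
      using L by (simp add: H_def)
    have A: "A \<ge> 1" "2 * w \<ge> 0" "2 * w + 4 \<le> A"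
      using w c by (auto simp: A_def)
    have "ln (real (card P) + 1) \<le> A"
      using c(2) w unfolding A_def by linarith
    then have "exp (ln (real (card P) + 1)) \<le> exp A"
      by (simp only: exp_le_cancel_iff)
    then have cardP: "real (card P) \<le> exp A"
      by simp
    define X where "X = exp (A * 16 ^ card F)"
    \<comment> \<open>From \<open>exp 1 \<ge> 2\<close> one gets \<open>16 \<le> exp 4\<close>, the
      source of the factor 4 in \<open>admissible\<close>.\<close>
    have "(16 :: real) = 2 ^ 4"
      by simp
    also have "\<dots> \<le> exp 1 ^ 4"
      using exp_ge_add_one_self[of 1] by (intro power_mono) auto
    also have "\<dots> = exp 4"
      by (simp flip: exp_of_nat_mult)
    finally have "(16 :: real) ^ card F \<le> exp 4 ^ card F"
      by (intro power_mono) auto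
    also have "\<dots> = exp (4 * real (card F))"
      by (simp flip: exp_of_nat_mult add: mult.commute)
    also have "\<dots> \<le> exp (4 * y)"
      using cardF by simp
    finally have "A * 16 ^ card F \<le> A * exp (4 * y)"
      using A(1) by (intro mult_left_mono) auto
    then have "A * 16 ^ card F \<le> ln L / 8"
      using b2 by (simp add: A_def)
    then have "X \<le> exp (ln L / 8)"
      by (simp add: X_def)
    also have "\<dots> = L powr (1/8)"
      using L by (simp add: powr_def)
    finally have X: "X \<le> L powr (1/8)" .
    have FH: "real (card F) * real (card H) \<le> y * (real K * L + 1)"
      using cardF cardH L by (intro mult_mono) auto
    have L2: "L\<^sup>2 \<ge> 4"
      using power_mono[of 2 L 2] L by simp
    have Q: "real Q \<le> L\<^sup>2" "L\<^sup>2 - 2 \<le> real (Q - 1)" "Q \<ge> 1"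
      using L2 unfolding Q_def by linarith+
    have "ln (real Q) \<le> ln (L\<^sup>2)"
      using Q by (intro ln_mono) auto
    then have lnQ: "ln (real Q) \<le> 2 * ln L"
      using L by (simp add: ln_realpow)
    have primes: "X + real (card F) * real (card H) \<le> real (card {p. prime p \<and> p \<le> Q})"
    proof -
      have "(X + real (card F) * real (card H)) * (2 * ln L)
          \<le> (L powr (1/8) + y * (real K * L + 1)) * (2 * ln L)"
        using X FH lnL by (intro mult_right_mono) auto
      also have "\<dots> \<le> (L\<^sup>2 - 2) * ln 2"
        by (rule b5)
      also have "\<dots> \<le> real (Q - 1) * ln 2"
        using Q(2) by (intro mult_right_mono) auto
      also have "\<dots> \<le> real (card {p. prime p \<and> p \<le> Q}) * ln (real Q)"
        by (rule prime_count_ge[OF Q(3)])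
      also have "\<dots> \<le> real (card {p. prime p \<and> p \<le> Q}) * (2 * ln L)"
        using lnQ by (intro mult_left_mono) auto
      finally show ?thesis
        using lnL by (simp add: mult_le_cancel_right)
    qed
    have \<alpha>: "\<forall>f\<in>F. 2 \<le> fst f \<and> fst f \<le> K"
      by (auto simp: F_def)
    have K1: "K \<ge> 1"
      using assms by simp
    have finFH: "finite F" "finite H"
      by (simp_all add: F_def H_def)
    obtain S \<phi> e where S: "finite S" "S \<inter> P = {}" "\<forall>p\<in>S. prime p \<and> \<phi> p \<in> F"
        "\<forall>f\<in>F. \<forall>h\<in>H. \<exists>p\<in>S. \<phi> p = f \<and> [fst f ^ h = fst f ^ e p] (mod p)"
        "(\<Sum>p\<in>S. ln (real p)) \<le> X\<^sup>2 * ln (real K)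
          + real (card F) * real (card H) * exp (- (2 * w)) * ln (real Q)"
      \<comment> \<open>The covering parameter is \<open>2 * w\<close>: a proportion
        \<open>1 / (ln L)^2\<close> of exponents stays uncovered, little enough to afford primes of
        logarithm \<open>2 * ln L\<close>.\<close>
      using full_covering[OF finFH(1) \<alpha> finFH(2) finP A cardP, folded X_def, OF primes K1]
      by (elim exE conjE) (rule that)
    have big: "p0 < p" if p: "p \<in> S" for p
    proof -
      have "p \<notin> P" "prime p"
        using S(2,3) p by blast+
      then show ?thesis
        by (simp add: P_def)
    qed
    have "X\<^sup>2 * ln (real K) \<le> (L powr (1/8))\<^sup>2 * ln (real K)"
      using X assms by (intro mult_right_mono power_mono) (auto simp: X_def)
    also have "(L powr (1/8))\<^sup>2 = L powr (1/4)"
      using L by (simp add: powr_power)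
    also note b3
    finally have s1: "X\<^sup>2 * ln (real K) \<le> \<epsilon> / 4 * L" .
    have "real (card F) * real (card H) * exp (- (2 * w)) * ln (real Q)
        \<le> y * (real K * L + 1) * exp (- (2 * w)) * (2 * ln L)"
    proof (rule mult_mono[OF mult_right_mono[OF FH] lnQ])
      have "0 \<le> y * (real K * L + 1)"
        using FH by (rule order.trans[rotated]) simp
      then show "0 \<le> y * (real K * L + 1) * exp (- (2 * w))"
        by simp
    qed (use Q(3) in simp_all)
    also note b4
    finally have s2: "real (card F) * real (card H) * exp (- (2 * w)) * ln (real Q) \<le> \<epsilon> / 4 * L" .
    have Spos: "\<Prod>S > 0"
      using S(3) by (intro prod_pos) (auto simp: prime_gt_0_nat)
    \<comment> \<open>Greedy primes and leftover primes each contribute at most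
      \<open>\<epsilon> / 4 * ln x\<close>, so the modulus is at most
      \<open>p0 * x powr (\<epsilon> / 2)\<close>.\<close>
    have "ln (real (\<Prod>S)) = (\<Sum>p\<in>S. ln (real p))"
      using S(1,3) by (simp add: ln_prod prime_gt_0_nat)
    also have "\<dots> \<le> \<epsilon> / 2 * L"
      using S(5) s1 s2 by simp
    finally have lnS: "ln (real (\<Prod>S)) \<le> \<epsilon> / 2 * L" .
    have "real (\<Prod>S) = exp (ln (real (\<Prod>S)))"
      using Spos by (simp only: exp_ln of_nat_0_less_iff)
    also have "\<dots> \<le> exp (\<epsilon> / 2 * L)"
      using lnS by (simp only: exp_le_cancel_iff)
    also have "\<dots> = x powr (\<epsilon> / 2)"
      using x by (simp add: powr_def L_def)
    finally have prodS: "real (\<Prod>S) \<le> x powr (\<epsilon> / 2)" .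
    have Sprop: "\<forall>p\<in>S. prime p \<and> K < p \<and> \<phi> p \<in> F"
      using S(3) big p0(2) less_trans by blast
    have p0S: "p0 \<notin> S"
      using big by blast
    obtain n0 where n0: "\<forall>n. [n = n0] (mod int (p0 * \<Prod>S)) \<longrightarrow>
        (\<forall>a j k s h. 2 \<le> a \<and> a \<le> K \<and> 1 \<le> j \<and> j \<le> K \<and> 1 \<le> k \<and> k \<le> K \<and> s \<in> {1, - 1} \<and> h \<in> H \<longrightarrow>
        R \<le> omega (n * int j + s * (int a ^ h * int k)))"
      using exists_residue_class_omega_ge[OF S(1), of K \<phi> R p0 H e, folded F_def, OF Sprop p0 p0S S(4)]
      by (elim exE) (rule that)
    let ?T = "{n::int. x \<le> real_of_int n \<and> real_of_int n \<le> (1 + 1 / real K) * x \<and>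
         (\<forall>a j k h::nat. 2 \<le> a \<and> a \<le> K \<and> 1 \<le> j \<and> j \<le> K \<and> 1 \<le> k \<and> k \<le> K \<and>
              real h \<le> real K * ln x \<longrightarrow>
            real (omega (n * int j + int a ^ h * int k)) \<ge> (ln (ln (ln x))) powr (1/3 - \<epsilon>) \<and>
            real (omega (n * int j - int a ^ h * int k)) \<ge> (ln (ln (ln x))) powr (1/3 - \<epsilon>))}"
    have finT: "finite ?T"
      by (rule finite_subset[of _ "{\<lceil>x\<rceil>..\<lfloor>(1 + 1 / real K) * x\<rfloor>}"])
         (auto simp: ceiling_le_iff le_floor_iff)
    have powR: "ln (ln (ln x)) powr (1/3 - \<epsilon>) \<le> real R"
    proof -
      have "w powr (1/3 - \<epsilon>) \<le> w powr (1/3)"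
        using w \<epsilon>(1) by (intro powr_mono) auto
      then show ?thesis
        using R(1) by (simp add: w_def L_def)
    qed
    define V where "V = {n::int. x \<le> real_of_int n \<and> real_of_int n \<le> (1 + 1 / real K) * x
      \<and> [n = n0] (mod int (p0 * \<Prod>S))}"
    have "V \<subseteq> ?T"
    proof
      fix n assume n: "n \<in> V"
      then have cong: "[n = n0] (mod int (p0 * \<Prod>S))"
        by (simp add: V_def)
      have "real R \<le> real (omega (n * int j + int a ^ h * int k)) \<and>
          real R \<le> real (omega (n * int j - int a ^ h * int k))"
        if ajk: "2 \<le> a \<and> a \<le> K \<and> 1 \<le> j \<and> j \<le> K \<and> 1 \<le> k \<and> k \<le> K \<and> real h \<le> real K * ln x"
        for a j k h
      proof -
        have "h \<in> H"
          using ajk by (auto simp: H_def L_def le_nat_floor)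
        then show ?thesis
          using n0[rule_format, OF cong, of a j k 1 h] n0[rule_format, OF cong, of a j k "- 1" h] ajk
          by simp
      qed
      then show "n \<in> ?T"
        using n powR unfolding V_def by (blast intro: order.trans)
    qed
    have W: "p0 * \<Prod>S > 0"
      using Spos p0 by simp
    \<comment> \<open>The class has about \<open>(x / K) / (p0 * \<Prod>S)\<close> members in the
      interval; the other half of \<open>\<epsilon>\<close> absorbs \<open>D\<close> and the
      rounding loss of 1.\<close>
    have "x powr (1 - \<epsilon>) \<le> x powr (1 - \<epsilon> / 2) / D - 1"
      by (rule b1)
    also have "x powr (1 - \<epsilon> / 2) / D = (x / real K) / (real p0 * x powr (\<epsilon> / 2))"
      using x by (simp add: D_def powr_diff)
    also have "\<dots> \<le> (x / real K) / real (p0 * \<Prod>S)"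
    proof (rule frac_le)
      show "real (p0 * \<Prod>S) \<le> real p0 * x powr (\<epsilon> / 2)"
        unfolding of_nat_mult using prodS by (rule mult_left_mono) simp
      show "0 < real (p0 * \<Prod>S)"
        using W by (simp only: of_nat_0_less_iff)
    qed (use x in simp_all)
    also have "x / real K = (1 + 1 / real K) * x - x"
      by (simp add: algebra_simps)
    also have "\<dots> / real (p0 * \<Prod>S) - 1 \<le> real (card V)"
      unfolding V_def by (rule card_residue_class_in_interval_ge[OF W])
    also have "\<dots> \<le> real (card ?T)"
      using \<open>V \<subseteq> ?T\<close> finT by (intro of_nat_mono card_mono)
    finally show "x powr (1 - \<epsilon>) \<le> real (card ?T)"
      by simp
  qed
qed simp

end
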